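(* Let $(M,\mathcal{T},\varepsilon,\eta)$ be a weighted triangulated connected closed surface with weights $\varepsilon: V\to\{0,1\}$ and $\eta: E\to\mathbb{R}$ satisfying $$\varepsilon_s\varepsilon_t+\eta_{st}>0\quad\text{for all } \{st\}\in E,$$ and $$\varepsilon_q\eta_{st}+\eta_{qs}\eta_{qt}\ge 0,\quad \{q,s,t\}=\{i,j,k\},$$ for every triangle $\{ijk\}\in F$. Let $\alpha\in\mathbb{R}$ be a constant and $\overline{R}:V\to\mathbb{R}$ a given function. (a) In the Euclidean background geometry: if $\alpha\overline{R}\equiv 0$, there exists at most one discrete conformal structure $f:V\to\mathbb{R}$ with combinatorial $\alpha$-curvature $\overline{R}$ up to adding a vector $c(1,1,\dots,1)$, $c\in\mathbb{R}$; if $\alpha\overline{R}\le 0$ and $\alpha\overline{R}\not\equiv 0$, there exists at most one discrete conformal structure $f:V\to\mathbb{R}$ with combinatorial $\alpha$-curvature $\overline{R}$. (b) In the hyperbolic background geometry: if $\alpha\overline{R}\le 0$, there exists at most one discrete conformal structure $f:V\to\mathbb{R}$ with combinatorial $\alpha$-curvature $\overline{R}$.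
   Context: $M$ is a connected closed surface with a triangulation $\mathcal{T}=(V,E,F)$ ($V,E,F$ the sets of vertices, edges, faces; $V$ finite, $|V|=N$); vertices, edges and faces are written $i$, $\{ij\}$, $\{ijk\}$. The weight $\eta$ satisfies $\eta_{ij}=\eta_{ji}$. Functions on $V$ are identified with vectors in $\mathbb{R}^N$; inequalities such as $\alpha\overline{R}\le 0$ are meant at every vertex. Discrete conformal structure: a function $f:V\to\mathbb{R}$ assigning to each edge $\{ij\}$ the length $$l_{ij}=\sqrt{\varepsilon_ie^{2f_i}+\varepsilon_je^{2f_j}+2\eta_{ij}e^{f_i+f_j}}\quad\text{(Euclidean background geometry)},$$ $$l_{ij}=\cosh^{-1}\left(\sqrt{(1+\varepsilon_ie^{2f_i})(1+\varepsilon_je^{2f_j})}+\eta_{ij}e^{f_i+f_j}\right)\quad\text{(hyperbolic background geometry)},$$ such that these lengths form a polyhedral metric, i.e. for every face $\{ijk\}$ the positive numbers $l_{ij},l_{ik},l_{jk}$ satisfy the three strict triangle inequalities, so that they are the edge lengths of a nondegenerate triangle in $\mathbb{E}^2$ (respectively $\mathbb{H}^2$). Let $\theta_i^{jk}$ be the inner angle at $i$ of this triangle. Classical combinatorial curvature: $K_i=2\pi-\sum_{\{ijk\}\in F}\theta_i^{jk}$, the sum being over the triangles having $i$ as a vertex. Combinatorial $\alpha$-curvature: $R_{\alpha,i}=K_i/e^{\alpha u_i}$, where $u_i=f_i$ in the Euclidean background geometry, and in the hyperbolic background geometry $u_i=f_i$ if $\varepsilon_i=0$, and $u_i=\frac12\ln\left|\frac{\sqrt{1+e^{2f_i}}-1}{\sqrt{1+e^{2f_i}}+1}\right|$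 if $\varepsilon_i=1$. *)

theory Defs
  imports "HOL-Analysis.Analysis"
begin

section \<open>Triangulated closed surfaces\<close>

text \<open>Hausdorff and locally Euclidean of dimension 2; second countability follows from compactness.\<close>

definition closed_surface :: "'a topology \<Rightarrow> bool" where
  "closed_surface M \<longleftrightarrow>
     compact_space M \<and> Hausdorff_space M \<and>
     (\<forall>x \<in> topspace M. \<exists>U. openin M U \<and> x \<in> U \<and>
        subtopology M U homeomorphic_space (euclidean :: (real^2) topology))"

text \<open>Geometric realization of the simplicial complex whose maximal simplices are the members of
  \<open>F\<close>, in barycentric coordinates. For a finite complex the topology of pointwise convergence on
  \<open>'v \<Rightarrow> real\<close> induces the usual topology.\<close>

definition realization :: "'v set set \<Rightarrow> ('v \<Rightarrow> real) set" where
  "realization F = {x. \<exists>T \<in> F. (\<forall>i. 0 \<le> x i) \<and> (\<forall>i. i \<notin> T \<longrightarrow> x i = 0) \<and> (\<Sum>i\<in>T. x i) = 1}"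

definition surface_triangulation ::
  "'a topology \<Rightarrow> 'v set \<Rightarrow> 'v set set \<Rightarrow> 'v set set \<Rightarrow> bool" where
  "surface_triangulation M V E F \<longleftrightarrow>
     finite V \<and> (\<forall>T \<in> F. card T = 3) \<and> V = \<Union>F \<and>
     E = {e. card e = 2 \<and> (\<exists>T \<in> F. e \<subseteq> T)} \<and>
     top_of_set (realization F) homeomorphic_space M"


section \<open>Geometric triangles\<close>

datatype geometry = Euclidean | Hyperbolic

text \<open>The hyperbolic plane is the upper sheet of the hyperboloid in Minkowski space.\<close>

definition mink :: "real^3 \<Rightarrow> real^3 \<Rightarrow> real" where
  "mink p q = p$1 * q$1 + p$2 * q$2 - p$3 * q$3"

definition hyp_plane :: "(real^3) set" where
  "hyp_plane = {p. mink p p = -1 \<and> 0 < p$3}"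

definition hyp_dist :: "real^3 \<Rightarrow> real^3 \<Rightarrow> real" where
  "hyp_dist p q = arcosh (- mink p q)"

definition euc_angle :: "real^2 \<Rightarrow> real^2 \<Rightarrow> real^2 \<Rightarrow> real" where
  "euc_angle p q r = arccos (((q - p) \<bullet> (r - p)) / (norm (q - p) * norm (r - p)))"

text \<open>The orthogonal projection of \<open>q\<close> to the tangent plane at \<open>p\<close>; it is a positive multiple of
  the initial velocity of the geodesic from \<open>p\<close> to \<open>q\<close>.\<close>

definition hyp_dir :: "real^3 \<Rightarrow> real^3 \<Rightarrow> real^3" where
  "hyp_dir p q = q + mink p q *\<^sub>R p"

definition hyp_angle :: "real^3 \<Rightarrow> real^3 \<Rightarrow> real^3 \<Rightarrow> real" where
  "hyp_angle p q r =
     arccos (mink (hyp_dir p q) (hyp_dir p r) /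
       (sqrt (mink (hyp_dir p q) (hyp_dir p q)) * sqrt (mink (hyp_dir p r) (hyp_dir p r))))"

text \<open>\<open>\<theta>\<close> is the angle enclosed by the sides of lengths \<open>a\<close> and \<open>b\<close> in a triangle whose third side
  has length \<open>c\<close>.\<close>

fun triangle_angle :: "geometry \<Rightarrow> real \<Rightarrow> real \<Rightarrow> real \<Rightarrow> real \<Rightarrow> bool" where
  "triangle_angle Euclidean a b c \<theta> \<longleftrightarrow>
     (\<exists>p q r. dist p q = a \<and> dist p r = b \<and> dist q r = c \<and> \<theta> = euc_angle p q r)"
| "triangle_angle Hyperbolic a b c \<theta> \<longleftrightarrow>
     (\<exists>p \<in> hyp_plane. \<exists>q \<in> hyp_plane. \<exists>r \<in> hyp_plane.
        hyp_dist p q = a \<and> hyp_dist p r = b \<and> hyp_dist q r = c \<and> \<theta> = hyp_angle p q r)"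


section \<open>Discrete conformal structures and curvatures\<close>

text \<open>The weight on the edge with endpoints \<open>i\<close>, \<open>j\<close> is \<open>\<eta> {i, j}\<close>. If \<open>\<epsilon>\<close> is \<open>{0, 1}\<close>-valued and
  \<open>\<epsilon> i * \<epsilon> j + \<eta> {i, j} > 0\<close>, the argument of the outer \<open>sqrt\<close> below is positive and that
  of \<open>arcosh\<close> exceeds 1.\<close>

fun edge_length ::
  "geometry \<Rightarrow> ('v \<Rightarrow> real) \<Rightarrow> ('v set \<Rightarrow> real) \<Rightarrow> ('v \<Rightarrow> real) \<Rightarrow> 'v \<Rightarrow> 'v \<Rightarrow> real" where
  "edge_length Euclidean \<epsilon> \<eta> f i j =
     sqrt (\<epsilon> i * exp (2 * f i) + \<epsilon> j * exp (2 * f j) + 2 * \<eta> {i, j} * exp (f i + f j))"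
| "edge_length Hyperbolic \<epsilon> \<eta> f i j =
     arcosh (sqrt ((1 + \<epsilon> i * exp (2 * f i)) * (1 + \<epsilon> j * exp (2 * f j)))
             + \<eta> {i, j} * exp (f i + f j))"

text \<open>Since \<open>i\<close>, \<open>j\<close>, \<open>k\<close> range over all orderings of a face, all three triangle inequalities are
  covered.\<close>

definition discrete_conformal_structure ::
  "geometry \<Rightarrow> 'v set set \<Rightarrow> ('v \<Rightarrow> real) \<Rightarrow> ('v set \<Rightarrow> real) \<Rightarrow> ('v \<Rightarrow> real) \<Rightarrow> bool" where
  "discrete_conformal_structure g F \<epsilon> \<eta> f \<longleftrightarrow>
     (\<forall>i j k. {i, j, k} \<in> F \<longrightarrow>
        0 < edge_length g \<epsilon> \<eta> f i j \<and>
        edge_length g \<epsilon> \<eta> f i j < edge_length g \<epsilon> \<eta> f i k + edge_length g \<epsilon> \<eta> f j k)"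

definition inner_angle ::
  "geometry \<Rightarrow> ('v \<Rightarrow> real) \<Rightarrow> ('v set \<Rightarrow> real) \<Rightarrow> ('v \<Rightarrow> real) \<Rightarrow> 'v set \<Rightarrow> 'v \<Rightarrow> real" where
  "inner_angle g \<epsilon> \<eta> f T i =
     (THE \<theta>. \<exists>j k. T = {i, j, k} \<and>
        triangle_angle g (edge_length g \<epsilon> \<eta> f i j) (edge_length g \<epsilon> \<eta> f i k)
          (edge_length g \<epsilon> \<eta> f j k) \<theta>)"

definition curvature ::
  "geometry \<Rightarrow> 'v set set \<Rightarrow> ('v \<Rightarrow> real) \<Rightarrow> ('v set \<Rightarrow> real) \<Rightarrow> ('v \<Rightarrow> real) \<Rightarrow> 'v \<Rightarrow> real" where
  "curvature g F \<epsilon> \<eta> f i = 2 * pi - (\<Sum>T \<in> {T \<in> F. i \<in> T}. inner_angle g \<epsilon> \<eta> f T i)"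

fun conformal_coord :: "geometry \<Rightarrow> ('v \<Rightarrow> real) \<Rightarrow> ('v \<Rightarrow> real) \<Rightarrow> 'v \<Rightarrow> real" where
  "conformal_coord Euclidean \<epsilon> f i = f i"
| "conformal_coord Hyperbolic \<epsilon> f i =
     (if \<epsilon> i = 0 then f i
      else 1/2 * ln \<bar>(sqrt (1 + exp (2 * f i)) - 1) / (sqrt (1 + exp (2 * f i)) + 1)\<bar>)"

definition alpha_curvature ::
  "geometry \<Rightarrow> 'v set set \<Rightarrow> ('v \<Rightarrow> real) \<Rightarrow> ('v set \<Rightarrow> real) \<Rightarrow> real \<Rightarrow> ('v \<Rightarrow> real) \<Rightarrow> 'v \<Rightarrow> real" where
  "alpha_curvature g F \<epsilon> \<eta> \<alpha> f i =
     curvature g F \<epsilon> \<eta> f i / exp (\<alpha> * conformal_coord g \<epsilon> f i)"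

definition has_alpha_curvature ::
  "geometry \<Rightarrow> 'v set \<Rightarrow> 'v set set \<Rightarrow> ('v \<Rightarrow> real) \<Rightarrow> ('v set \<Rightarrow> real) \<Rightarrow> real \<Rightarrow>
     ('v \<Rightarrow> real) \<Rightarrow> ('v \<Rightarrow> real) \<Rightarrow> bool" where
  "has_alpha_curvature g V F \<epsilon> \<eta> \<alpha> R f \<longleftrightarrow>
     discrete_conformal_structure g F \<epsilon> \<eta> f \<and> (\<forall>i \<in> V. alpha_curvature g F \<epsilon> \<eta> \<alpha> f i = R i)"

end

theory Submission
  imports Defs
begin

text \<open>Let \<open>u\<close> and \<open>v\<close> be the conformal coordinates of two discrete conformal structures with the
  same \<open>\<alpha>\<close>-curvature and let \<open>d = v - u\<close>. For each face consider the function
  \<open>t \<mapsto> \<Sum>\<^sub>i d\<^sub>i \<theta>\<^sub>i(u + t d)\<close>. While the triangle inequalities hold, its derivative is a quadratic form in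
  \<open>d\<close> whose coefficients are the signed heights of the power centre over the edges; the structure
  condition forces at most one of them to be negative, and the form is then negative (modulo the
  scaling direction in the Euclidean case). The segment may leave the admissible region, where the
  angles are continued by \<open>0\<close> and \<open>\<pi>\<close>: there the function takes only finitely many values, and a
  continuous function that decreases wherever it avoids a finite set of values is nonincreasing. So
  no potential and no topology of the admissible region is needed. Summing over all faces gives
  \<open>\<Sum>\<^sub>i d\<^sub>i (K\<^sub>i(v) - K\<^sub>i(u)) \<ge> 0\<close>, while \<open>K\<^sub>i = R\<^sub>i exp (\<alpha> u\<^sub>i)\<close> with \<open>\<alpha> R \<le> 0\<close> gives the reverse
  inequality, so equality holds in every face.\<close>

section \<open>Weights of a face\<close>

text \<open>Coefficients of either sign rule out a term-by-term argument, so definiteness also needs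
  the determinant of the form. That determinant factors: up to positive factors, among them a power
  of \<open>D\<close>, it is the Jacobian determinant of the hyperbolic cosines of the three sides
  with respect to the conformal coordinates. In the Euclidean case the scaling direction lies in the
  kernel; there a 2x2 minor replaces the determinant and the squared lengths replace the cosines.
  The Jacobian determinant is a sum of two triple products, and its positivity is a statement about
  the weights alone (\<open>jacobian_pos\<close>). With one negative coefficient, a positive
  determinant and a positive value on a suitable plane exclude a negative direction. The finite set
  of exceptional values arises because \<open>D\<close> is the common discriminant of the three
  angles of a face: they degenerate simultaneously, and otherwise their derivatives share the factor
  \<open>1 / sqrt D\<close>, so only numerators matter for the sign.\<close>

text \<open>Here \<open>a\<close>, \<open>b\<close>, \<open>c\<close> are the weights of the edges opposite to the vertices 1, 2, 3.\<close>

locale face_weights =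
  fixes e1 e2 e3 a b c :: real
  assumes eps: "e1 \<in> {0, 1}" "e2 \<in> {0, 1}" "e3 \<in> {0, 1}"
    and edge: "e2 * e3 + a > 0" "e1 * e3 + b > 0" "e1 * e2 + c > 0"
    and gamma: "e1 * a + b * c \<ge> 0" "e2 * b + a * c \<ge> 0" "e3 * c + a * b \<ge> 0"
begin

lemma rotate: "face_weights e2 e3 e1 b c a"
  using eps edge gamma by unfold_locales (auto simp: mult.commute)

text \<open>Applied with \<open>x1 = r1\<close> in the Euclidean and
  \<open>x1 = r1 * h2 * h3\<close> in the hyperbolic case (cyclically), where it is the Jacobian
  determinant up to positive factors. The inequality between arithmetic and geometric mean replaces
  the squares and leaves \<open>x1*x2*x3\<close> times a constant that factors, for instance into
  \<open>2 * ((1 + a) * (1 + b) * (1 + c))\<close>.\<close>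

lemma jacobian_pos:
  assumes x: "x1 > 0" "x2 > 0" "x3 > 0"
  shows "(e2*x2 + a*x3) * (e3*x3 + b*x1) * (e1*x1 + c*x2) +
         (e3*x3 + a*x2) * (e1*x1 + b*x3) * (e2*x2 + c*x1) > 0" (is "?D > 0")
proof -
  have amgm: "2 * (x * y * z) \<le> (x\<^sup>2 + y\<^sup>2) * z" if "z > 0" for x y z :: real
    using mult_right_mono[OF sum_squares_bound[of x y], of z] that by (simp add: mult_ac)
  have expand: "?D = (e2*b + a*c) * ((e1*x1\<^sup>2 + e3*x3\<^sup>2) * x2)
     + (e3*c + a*b) * ((e1*x1\<^sup>2 + e2*x2\<^sup>2) * x3)
     + (e1*a + b*c) * ((e2*x2\<^sup>2 + e3*x3\<^sup>2) * x1)
     + 2*(e1*e2*e3 + a*b*c)*(x1*x2*x3)"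
    by algebra
  have n: "(e2*b + a*c) * ((e1*x1\<^sup>2 + e3*x3\<^sup>2) * x2) \<ge> 0"
    "(e3*c + a*b) * ((e1*x1\<^sup>2 + e2*x2\<^sup>2) * x3) \<ge> 0"
    "(e1*a + b*c) * ((e2*x2\<^sup>2 + e3*x3\<^sup>2) * x1) \<ge> 0"
    using gamma x eps by auto
  have m2: "(e2*b + a*c) * (2 * (x1*x3*x2)) \<le> (e2*b + a*c) * ((e1*x1\<^sup>2 + e3*x3\<^sup>2) * x2)"
    if "e1 = 1" "e3 = 1"
    using mult_left_mono[OF amgm[OF x(2), of x1 x3] gamma(2)] that by simp
  have m3: "(e3*c + a*b) * (2 * (x1*x2*x3)) \<le> (e3*c + a*b) * ((e1*x1\<^sup>2 + e2*x2\<^sup>2) * x3)"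
    if "e1 = 1" "e2 = 1"
    using mult_left_mono[OF amgm[OF x(3), of x1 x2] gamma(3)] that by simp
  have m1: "(e1*a + b*c) * (2 * (x2*x3*x1)) \<le> (e1*a + b*c) * ((e2*x2\<^sup>2 + e3*x3\<^sup>2) * x1)"
    if "e2 = 1" "e3 = 1"
    using mult_left_mono[OF amgm[OF x(1), of x2 x3] gamma(1)] that by simp
  have xxx: "x1*x2*x3 > 0" using x by simp
  \<comment> \<open>If at most one of \<open>e1\<close>, \<open>e2\<close>, \<open>e3\<close> is 1,
    the products in the edge condition vanish and all weights are positive. The remaining cases have
    three or exactly two of them equal to 1.\<close>
  have "(a > 0 \<and> b > 0 \<and> c > 0) \<or> (e1 = 1 \<and> e2 = 1 \<and> e3 = 1) \<or> (e1 = 1 \<and> e2 = 1 \<and> e3 = 0)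
      \<or> (e1 = 1 \<and> e2 = 0 \<and> e3 = 1) \<or> (e1 = 0 \<and> e2 = 1 \<and> e3 = 1)"
    using eps edge by (cases "e1 = 0"; cases "e2 = 0"; cases "e3 = 0") simp_all
  then consider "a > 0" "b > 0" "c > 0" | "e1 = 1" "e2 = 1" "e3 = 1"
    | "e1 = 1" "e2 = 1" "e3 = 0" | "e1 = 1" "e2 = 0" "e3 = 1" | "e1 = 0" "e2 = 1" "e3 = 1"
    by blast
  then show ?thesis
  proof cases
    case 1
    have "e1 \<ge> 0" "e2 \<ge> 0" "e3 \<ge> 0" using eps by auto
    with 1 x show ?thesis
      by (intro add_pos_pos mult_pos_pos add_nonneg_pos mult_nonneg_nonneg) auto
  next
    case 2
    have "0 < 2 * ((1 + a) * (1 + b) * (1 + c)) * (x1*x2*x3)"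
      using edge 2 xxx by simp
    also have "\<dots> = (e2*b + a*c) * (2 * (x1*x3*x2)) + (e3*c + a*b) * (2 * (x1*x2*x3))
      + (e1*a + b*c) * (2 * (x2*x3*x1)) + 2*(e1*e2*e3 + a*b*c)*(x1*x2*x3)"
      using 2 by (simp add: algebra_simps)
    also have "\<dots> \<le> ?D" unfolding expand
      by (intro add_mono m1 m2 m3 order_refl 2)
    finally show ?thesis .
  next
    case 3
    have "0 < 2 * (a * b * (1 + c)) * (x1*x2*x3)" using edge 3 xxx by simp
    also have "\<dots> = 0 + (e3*c + a*b) * (2 * (x1*x2*x3)) + 0 + 2*(e1*e2*e3 + a*b*c)*(x1*x2*x3)"
      using 3 by (simp add: algebra_simps)
    also have "\<dots> \<le> ?D" unfolding expand
      by (intro add_mono m3 n order_refl 3)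
    finally show ?thesis .
  next
    case 4
    have "0 < 2 * (a * c * (1 + b)) * (x1*x2*x3)" using edge 4 xxx by simp
    also have "\<dots> = (e2*b + a*c) * (2 * (x1*x3*x2)) + 0 + 0 + 2*(e1*e2*e3 + a*b*c)*(x1*x2*x3)"
      using 4 by (simp add: algebra_simps)
    also have "\<dots> \<le> ?D" unfolding expand
      by (intro add_mono m2 n order_refl 4)
    finally show ?thesis .
  next
    case 5
    have "0 < 2 * (b * c * (1 + a)) * (x1*x2*x3)" using edge 5 xxx by simp
    also have "\<dots> = 0 + 0 + (e1*a + b*c) * (2 * (x2*x3*x1)) + 2*(e1*e2*e3 + a*b*c)*(x1*x2*x3)"
      using 5 by (simp add: algebra_simps)
    also have "\<dots> \<le> ?D" unfolding expand
      by (intro add_mono m1 n order_refl 5)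
    finally show ?thesis .
  qed
qed

text \<open>The left-hand side of the last assumption is a positive multiple of the signed height of the
  power centre over the edge opposite to vertex 1.\<close>

lemma height_neg_imp:
  assumes x: "x1 > 0" "x2 > 0" "x3 > 0"
    and "x1 * (e2*e3 - a\<^sup>2) + x2 * (e3*c + a*b) + x3 * (e2*b + a*c) < 0"
  shows "a > 0" "a\<^sup>2 > e2*e3" "x2 * (e3*c + a*b) < x1 * (a\<^sup>2 - e2*e3)"
proof -
  have "x2 * (e3*c + a*b) \<ge> 0" "x3 * (e2*b + a*c) \<ge> 0" using x gamma by simp_all
  with assms(4) show 1: "x2 * (e3*c + a*b) < x1 * (a\<^sup>2 - e2*e3)"
    and "a\<^sup>2 > e2*e3"
    subgoal by (simp add: algebra_simps)
    subgoal using \<open>x2 * (e3*c + a*b) \<ge> 0\<close> \<open>x3 * (e2*b + a*c) \<ge> 0\<close> assms(4) x(1)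
      by (smt (verit) mult_nonneg_nonneg)
    done
  show "a > 0"
  proof (rule ccontr)
    assume "\<not> a > 0"
    then have "e2 = 1" "e3 = 1" using eps edge by auto
    then have "a > -1" "a \<le> 0" using edge \<open>\<not> a > 0\<close> by auto
    then have "a\<^sup>2 \<le> 1" by (simp add: abs_square_le_1)
    with \<open>a\<^sup>2 > e2*e3\<close> \<open>e2 = 1\<close> \<open>e3 = 1\<close> show False by simp
  qed
qed

text \<open>Two negative heights bound the shared mixed term \<open>e3*c + a*b\<close> from above in
  two ways. Multiplying the bounds cancels \<open>x1\<close> and \<open>x2\<close>, and the
  resulting inequality between weights alone is impossible.\<close>

lemma height_not_both_neg:
  assumes x: "x1 > 0" "x2 > 0" "x3 > 0"
    and 1: "x1 * (e2*e3 - a\<^sup>2) + x2 * (e3*c + a*b) + x3 * (e2*b + a*c) < 0"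
  shows "x2 * (e3*e1 - b\<^sup>2) + x3 * (e1*a + b*c) + x1 * (e3*c + a*b) \<ge> 0"
proof (rule ccontr)
  interpret S: face_weights e2 e1 e3 b a c
    using eps edge gamma by unfold_locales (auto simp: mult.commute add.commute)
  assume "\<not> ?thesis"
  then have 2: "x2 * (e1*e3 - b\<^sup>2) + x1 * (e3*c + b*a) + x3 * (e1*a + b*c) < 0"
    by (simp add: algebra_simps)
  note A = height_neg_imp[OF x 1] and B = S.height_neg_imp[OF x(2,1,3) 2]
  let ?g = "e3*c + a*b"
  have "(x2 * ?g) * (x1 * ?g) < (x1 * (a\<^sup>2 - e2*e3)) * (x2 * (b\<^sup>2 - e1*e3))"
    by (rule mult_strict_mono') (use A B x gamma in \<open>auto simp: mult.commute[of b a]\<close>)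
  then have "(x1 * x2) * ?g\<^sup>2 < (x1 * x2) * ((a\<^sup>2 - e2*e3) * (b\<^sup>2 - e1*e3))"
    by (simp add: power2_eq_square algebra_simps)
  then have less: "?g\<^sup>2 < (a\<^sup>2 - e2*e3) * (b\<^sup>2 - e1*e3)" using x by simp
  \<comment> \<open>For \<open>e3 = 0\<close> both sides of \<open>less\<close> coincide. If
    \<open>e3 = 1\<close> and \<open>e1\<close>, \<open>e2\<close> are not both 1, the edge
    condition gives \<open>c > 0\<close>, hence \<open>e3*c + a*b > a*b\<close>. With three ones
    only \<open>c > -1\<close> is known, and the gap is closed by the square of
    \<open>a - b\<close>.\<close>
  have "e3 = 0 \<or> (e3 = 1 \<and> e1 = 1 \<and> e2 = 1) \<or> (e3 = 1 \<and> c > 0 \<and> e1 \<ge> 0 \<and> e2 \<ge> 0)"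
    using eps edge by (cases "e1 = 0"; cases "e2 = 0"; cases "e3 = 0") simp_all
  then consider "e3 = 0" | "e3 = 1" "e1 = 1" "e2 = 1" | "e3 = 1" "c > 0" "e1 \<ge> 0" "e2 \<ge> 0"
    by blast
  then show False
  proof cases
    case 1 then show False using less by (simp add: power_mult_distrib)
  next
    case 2
    have "a > 1" "b > 1" using A B 2 by (auto simp: power2_gt_1_iff)
    then have "a * b > 1" by (rule less_1_mult)
    then have "(a*b - 1)\<^sup>2 \<le> ?g\<^sup>2" using edge 2 by (intro power_mono) auto
    moreover have "(a\<^sup>2 - 1) * (b\<^sup>2 - 1) \<le> (a*b - 1)\<^sup>2"
      using zero_le_power2[of "a - b"] by (simp add: power2_eq_square algebra_simps)
    ultimately show False using less 2 by simp
  next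
    case 3
    have "(a\<^sup>2 - e2*e3) * (b\<^sup>2 - e1*e3) \<le> a\<^sup>2 * b\<^sup>2"
      using 3 A B by (intro mult_mono) auto
    also have "\<dots> \<le> ?g\<^sup>2" using 3 A B
      by (simp flip: power_mult_distrib)
    finally show False using less by simp
  qed
qed

end

section \<open>The quadratic form of a hyperbolic face\<close>

text \<open>Removes the denominator \<open>s\<close> from one term of an angle derivative: the
  weight \<open>w\<close> is chosen so that both coefficients become polynomial in \<open>w\<close>
  and the other quantities.\<close>

lemma foot_quotient:
  fixes h p q x y z s w d d' :: real
  assumes "s = z\<^sup>2 - 1" "s \<noteq> 0" "w * s = h * (1 - z\<^sup>2) + p * (z*x - y) + q * (z*y - x)"
  shows "(z*x - y) / s * ((p*z - q) * d + (q*z - p) * d') = (z*w + z*h - q*y) * d + (q*x - h - w) * d'"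
proof -
  have "(z*x - y) * (p*z - q) = s * (z*w + z*h - q*y)" "(z*x - y) * (q*z - p) = s * (q*x - h - w)"
    using assms by algebra+
  then have "(z*x - y) / s * (p*z - q) = z*w + z*h - q*y" "(z*x - y) / s * (q*z - p) = q*x - h - w"
    using assms(2) by simp_all
  then show ?thesis by (simp add: distrib_left flip: mult.assoc)
qed

text \<open>\<open>E1\<close>, \<open>E2\<close>, \<open>E3\<close> are the derivatives, in
  direction \<open>d\<close>, of the hyperbolic cosines of the sides. By the law of cosines each
  bracket is the derivative of an angle times the square root of the Gram determinant. Regrouping by
  edges leaves a single factor \<open>w1\<close>, \<open>w2\<close> or \<open>w3\<close> per
  edge.\<close>

lemma hyp_angle_form:
  fixes c1 c2 c3 d1 d2 d3 h1 h2 h3 :: real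
  defines "E1 \<equiv> (h2*c1-h3)*d2 + (h3*c1-h2)*d3"
      and "E2 \<equiv> (h3*c2-h1)*d3 + (h1*c2-h3)*d1"
      and "E3 \<equiv> (h1*c3-h2)*d1 + (h2*c3-h1)*d2"
  assumes s: "s1 = c1\<^sup>2 - 1" "s2 = c2\<^sup>2 - 1" "s3 = c3\<^sup>2 - 1" "s1 \<noteq> 0" "s2 \<noteq> 0" "s3 \<noteq> 0"
    and w: "w1 * s1 = h1 * (1 - c1\<^sup>2) + h2 * (c1*c2 - c3) + h3 * (c1*c3 - c2)"
       "w2 * s2 = h2 * (1 - c2\<^sup>2) + h3 * (c2*c3 - c1) + h1 * (c2*c1 - c3)"
       "w3 * s3 = h3 * (1 - c3\<^sup>2) + h1 * (c3*c1 - c2) + h2 * (c3*c2 - c1)"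
  shows "d1 * (E1 - (c2*c1-c3)/s2*E2 - (c3*c1-c2)/s3*E3)
       + d2 * (E2 - (c3*c2-c1)/s3*E3 - (c1*c2-c3)/s1*E1)
       + d3 * (E3 - (c1*c3-c2)/s1*E1 - (c2*c3-c1)/s2*E2)
     = - (w1 * (c1*(d2\<^sup>2+d3\<^sup>2) - 2*d2*d3) + w2 * (c2*(d3\<^sup>2+d1\<^sup>2) - 2*d3*d1)
          + w3 * (c3*(d1\<^sup>2+d2\<^sup>2) - 2*d1*d2))"
proof -
  have 1: "(c2*c1-c3)/s2*E2 = (c2*w2 + c2*h2 - h3*c3) * d1 + (h3*c1 - h2 - w2) * d3"
    using foot_quotient[OF s(2,5), of w2 h2 h1 c1 c3 h3 d1 d3] w(2) by (simp add: E2_def add_ac)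
  have 2: "(c3*c1-c2)/s3*E3 = (c3*w3 + c3*h3 - h2*c2) * d1 + (h2*c1 - h3 - w3) * d2"
    using foot_quotient[OF s(3,6), of w3 h3 h1 c1 c2 h2 d1 d2] w(3) by (simp add: E3_def add_ac)
  have 3: "(c3*c2-c1)/s3*E3 = (c3*w3 + c3*h3 - h1*c1) * d2 + (h1*c2 - h3 - w3) * d1"
    using foot_quotient[OF s(3,6), of w3 h3 h2 c2 c1 h1 d2 d1] w(3) by (simp add: E3_def add_ac)
  have 4: "(c1*c2-c3)/s1*E1 = (c1*w1 + c1*h1 - h3*c3) * d2 + (h3*c2 - h1 - w1) * d3"
    using foot_quotient[OF s(1,4), of w1 h1 h2 c2 c3 h3 d2 d3] w(1) by (simp add: E1_def add_ac)
  have 5: "(c1*c3-c2)/s1*E1 = (c1*w1 + c1*h1 - h2*c2) * d3 + (h2*c3 - h1 - w1) * d2"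
    using foot_quotient[OF s(1,4), of w1 h1 h3 c3 c2 h2 d3 d2] w(1) by (simp add: E1_def add_ac)
  have 6: "(c2*c3-c1)/s2*E2 = (c2*w2 + c2*h2 - h1*c1) * d3 + (h1*c3 - h2 - w2) * d1"
    using foot_quotient[OF s(2,5), of w2 h2 h3 c3 c1 h1 d3 d1] w(2) by (simp add: E2_def add_ac)
  show ?thesis unfolding 1 2 3 4 5 6 unfolding E1_def E2_def E3_def by algebra
qed

text \<open>The last bracket is the determinant of the matrix of the form in
  \<open>hyp_angle_form\<close>. The left-hand side is, up to a positive factor, what the Jacobian
  determinant becomes when its entries are expressed by the weights.\<close>

lemma hyp_det_identity:
  fixes c1 c2 c3 w1 w2 w3 :: real
  assumes "s1 = c1\<^sup>2 - 1" "s2 = c2\<^sup>2 - 1" "s3 = c3\<^sup>2 - 1"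
  shows "((c1*c3-c2)*w1 + s3*w3) * (s1*w1 + (c1*c2-c3)*w2) * (s2*w2 + (c2*c3-c1)*w3)
     + ((c1*c2-c3)*w1 + s2*w2) * ((c2*c3-c1)*w2 + s3*w3) * (s1*w1 + (c1*c3-c2)*w3)
   = (1 + 2*c1*c2*c3 - c1\<^sup>2 - c2\<^sup>2 - c3\<^sup>2) *
     (2*(c1*c2*c3-1)*w1*w2*w3 + w1\<^sup>2* s1*(c2*w2+c3*w3) + w2\<^sup>2* s2*(c1*w1+c3*w3) + w3\<^sup>2* s3*(c1*w1+c2*w2))"
  unfolding assms by algebra

lemma form_pos_of_nonneg:
  fixes c1 c2 c3 w1 w2 w3 :: real
  assumes c: "c1 > 1" "c2 > 1" "c3 > 1" and w: "w1 \<ge> 0" "w2 \<ge> 0" "w3 \<ge> 0"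
    and det: "2*(c1*c2*c3-1)*w1*w2*w3 + w1\<^sup>2 * (c1\<^sup>2-1) * (c2*w2+c3*w3)
      + w2\<^sup>2 * (c2\<^sup>2-1) * (c1*w1+c3*w3) + w3\<^sup>2 * (c3\<^sup>2-1) * (c1*w1+c2*w2) > 0"
    and d: "\<not> (d1 = 0 \<and> d2 = 0 \<and> d3 = 0)"
  shows "w1 * (c1*(d2\<^sup>2+d3\<^sup>2) - 2*d2*d3) + w2 * (c2*(d3\<^sup>2+d1\<^sup>2) - 2*d3*d1)
          + w3 * (c3*(d1\<^sup>2+d2\<^sup>2) - 2*d1*d2) > 0"
proof -
  have pos: "c*(x\<^sup>2+y\<^sup>2) - 2*x*y > 0" if "c > 1" "x \<noteq> 0 \<or> y \<noteq> 0" for c x y :: real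
  proof -
    have "x\<^sup>2+y\<^sup>2 > 0" using that by (simp add: sum_power2_gt_zero_iff)
    then have "c*(x\<^sup>2+y\<^sup>2) > x\<^sup>2+y\<^sup>2" using that by simp
    moreover have "x\<^sup>2+y\<^sup>2 \<ge> 2*x*y" by (rule sum_squares_bound)
    ultimately show ?thesis by (simp only: diff_gt_0_iff_gt)
  qed
  have nn: "c*(x\<^sup>2+y\<^sup>2) - 2*x*y \<ge> 0" if "c > 1" for c x y :: real
    using pos[OF that, of x y] by (cases "x = 0 \<and> y = 0") auto
  note N = mult_nonneg_nonneg[OF w(1) nn[OF c(1), of d2 d3]]
    mult_nonneg_nonneg[OF w(2) nn[OF c(2), of d3 d1]]
    mult_nonneg_nonneg[OF w(3) nn[OF c(3), of d1 d2]]
  \<comment> \<open>Two vanishing weights would make the determinant 0, and a nonzero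
    \<open>d\<close> is nonzero on at least two edges. Two pairs out of three edges share an edge,
    and the term of that edge is strictly positive.\<close>
  have "w1 > 0 \<and> w2 > 0 \<or> w2 > 0 \<and> w3 > 0 \<or> w1 > 0 \<and> w3 > 0"
    using det w by (auto simp: less_le)
  moreover have "(d2 \<noteq> 0 \<or> d3 \<noteq> 0) \<and> (d3 \<noteq> 0 \<or> d1 \<noteq> 0) \<or>
     (d3 \<noteq> 0 \<or> d1 \<noteq> 0) \<and> (d1 \<noteq> 0 \<or> d2 \<noteq> 0) \<or> (d2 \<noteq> 0 \<or> d3 \<noteq> 0) \<and> (d1 \<noteq> 0 \<or> d2 \<noteq> 0)"
    using d by auto
  ultimately show ?thesis
    using N mult_pos_pos[OF _ pos[OF c(1), of d2 d3], of w1]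
      mult_pos_pos[OF _ pos[OF c(2), of d3 d1], of w2]
      mult_pos_pos[OF _ pos[OF c(3), of d1 d2], of w3]
    by (smt (verit, best))
qed

text \<open>The vector \<open>v = (c2, c1, 1)\<close> is orthogonal to the third unit vector \<open>e\<close> with respect to the form,
  which is positive on both; as the determinant is positive, there is no room for a negative
  direction. The proof completes squares in the basis \<open>e\<close>, \<open>v\<close>, \<open>(1, 0, 0)\<close>.\<close>

lemma form_pos_of_one_neg:
  fixes c1 c2 c3 w1 w2 w3 :: real
  assumes c: "c1 > 1" "c2 > 1" "c3 > 1" and w: "w1 \<ge> 0" "w2 \<ge> 0"
    and det: "2*(c1*c2*c3-1)*w1*w2*w3 + w1\<^sup>2 * (c1\<^sup>2-1) * (c2*w2+c3*w3)
      + w2\<^sup>2 * (c2\<^sup>2-1) * (c1*w1+c3*w3) + w3\<^sup>2 * (c3\<^sup>2-1) * (c1*w1+c2*w2) > 0"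
    and q: "(c2\<^sup>2-1) * w2 + (c2*c3-c1) * w3 > 0" "(c1\<^sup>2-1) * w1 + (c1*c3-c2) * w3 > 0"
    and d: "\<not> (d1 = 0 \<and> d2 = 0 \<and> d3 = 0)"
  shows "w1 * (c1*(d2\<^sup>2+d3\<^sup>2) - 2*d2*d3) + w2 * (c2*(d3\<^sup>2+d1\<^sup>2) - 2*d3*d1)
          + w3 * (c3*(d1\<^sup>2+d2\<^sup>2) - 2*d1*d2) > 0" (is "?Q > 0")
proof -
  let ?det = "2*(c1*c2*c3-1)*w1*w2*w3 + w1\<^sup>2 * (c1\<^sup>2-1) * (c2*w2+c3*w3)
      + w2\<^sup>2 * (c2\<^sup>2-1) * (c1*w1+c3*w3) + w3\<^sup>2 * (c3\<^sup>2-1) * (c1*w1+c2*w2)"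
  \<comment> \<open>\<open>p\<close> is the value of the form at \<open>e\<close>. Its matrix maps
    \<open>v\<close> to \<open>(q1, q2, 0)\<close>, so the value at \<open>v\<close> is
    \<open>m = c2*q1 + c1*q2\<close>.\<close>
  define p q1 q2 where "p = c1*w1 + c2*w2"
    and "q1 = (c2\<^sup>2-1) * w2 + (c2*c3-c1) * w3" and "q2 = (c1\<^sup>2-1) * w1 + (c1*c3-c2) * w3"
  define m where "m = c2*q1 + c1*q2"
  \<comment> \<open>Coordinates in the basis, scaled by \<open>c1\<close> to avoid division:
    \<open>c1 * d\<close> is \<open>s\<close> times \<open>e\<close> plus \<open>d2\<close> times
    \<open>v\<close> plus \<open>u\<close> times \<open>(1, 0, 0)\<close>.\<close>
  define s u where "s = c1*d3 - d2" and "u = c1*d1 - c2*d2"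
  have "p > 0"
  proof -
    have "w1 > 0 \<or> w2 > 0" using det w by (auto simp: less_le)
    then show ?thesis unfolding p_def using w c
      by (metis add_nonneg_pos add_pos_nonneg less_eq_real_def less_trans mult_nonneg_nonneg mult_pos_pos zero_less_one)
  qed
  have "m > 0" unfolding m_def using q c by (intro add_pos_pos mult_pos_pos) (auto simp: q1_def q2_def)
  have sq: "c1\<^sup>2 * (p * m) * ?Q = m * (p * s - w2*u)\<^sup>2 + p * (m*d2 + q1*u)\<^sup>2 + (c1\<^sup>2 * ?det) * u\<^sup>2"
    unfolding m_def p_def q1_def q2_def s_def u_def by algebra
  show ?thesis
  proof (rule ccontr)
    assume "\<not> ?Q > 0"
    then have "c1\<^sup>2 * (p * m) * ?Q \<le> 0"
      using \<open>p > 0\<close> \<open>m > 0\<close> by (intro mult_nonneg_nonpos) auto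
    moreover have "m * (p * s - w2*u)\<^sup>2 \<ge> 0" "p * (m*d2 + q1*u)\<^sup>2 \<ge> 0" "(c1\<^sup>2 * ?det) * u\<^sup>2 \<ge> 0"
      using \<open>p > 0\<close> \<open>m > 0\<close> det by (auto intro!: mult_nonneg_nonneg simp del: mult_less_0_iff)
    ultimately have "m * (p * s - w2*u)\<^sup>2 = 0" "p * (m*d2 + q1*u)\<^sup>2 = 0" "(c1\<^sup>2 * ?det) * u\<^sup>2 = 0"
      unfolding sq by linarith+
    moreover have "c1\<^sup>2 * ?det > 0" using det c by (intro mult_pos_pos) auto
    ultimately have "u = 0" "d2 = 0" "s = 0" using \<open>p > 0\<close> \<open>m > 0\<close> by auto
    then show False using d c by (auto simp: s_def u_def)
  qed
qed

text \<open>For two circles, \<open>h * h' - r * r'\<close> is the hyperbolic cosine of the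
  difference of the radii and thus at least 1. In general \<open>h * h'\<close> is at least
  \<open>1 + e * e' * (r * r')\<close>, and the edge condition supplies the strict surplus.\<close>

lemma cosh_edge_gt_1:
  fixes e e' :: real
  assumes "e \<in> {0,1}" "e' \<in> {0,1}" "e * e' + a > 0" "r > 0" "r' > 0" "h > 0" "h' > 0"
    "h\<^sup>2 = 1 + e * r\<^sup>2" "h'\<^sup>2 = 1 + e' * r'\<^sup>2"
  shows "h * h' + a * (r * r') > 1"
proof -
  have "1 + e * e' * (r * r') \<le> h * h'"
  proof (rule power2_le_imp_le)
    have "2 * r * r' \<le> r\<^sup>2 + r'\<^sup>2" by (rule sum_squares_bound)
    then show "(1 + e * e' * (r * r'))\<^sup>2 \<le> (h * h')\<^sup>2"
      unfolding power_mult_distrib \<open>h\<^sup>2 = _\<close> \<open>h'\<^sup>2 = _\<close>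
      using assms(1,2) by (auto simp: power2_eq_square algebra_simps)
  qed (use assms in auto)
  moreover have "(e * e' + a) * (r * r') > 0" using assms by simp
  ultimately show ?thesis by (simp add: algebra_simps)
qed

text \<open>For a vertex circle of hyperbolic radius \<open>\<rho>\<close> (the case \<open>ei = 1\<close>), \<open>ri = sinh \<rho>\<close> and \<open>hi = cosh \<rho>\<close>; \<open>ci\<close>
  is the hyperbolic cosine of the side opposite to vertex \<open>i\<close>, and \<open>D\<close> is the Gram determinant,
  which is positive iff the three sides form a nondegenerate triangle.\<close>

locale hyp_face = face_weights +
  fixes r1 r2 r3 h1 h2 h3 c1 c2 c3 D s1 s2 s3 w1 w2 w3 :: real
  assumes r: "r1 > 0" "r2 > 0" "r3 > 0" and h: "h1 > 0" "h2 > 0" "h3 > 0"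
    and hr: "h1\<^sup>2 = 1 + e1 * r1\<^sup>2" "h2\<^sup>2 = 1 + e2 * r2\<^sup>2" "h3\<^sup>2 = 1 + e3 * r3\<^sup>2"
    and c1: "c1 = h2 * h3 + a * (r2 * r3)" and c2: "c2 = h1 * h3 + b * (r1 * r3)"
    and c3: "c3 = h1 * h2 + c * (r1 * r2)"
    and D: "D = 1 + 2*c1*c2*c3 - c1\<^sup>2 - c2\<^sup>2 - c3\<^sup>2" "D > 0"
    and s: "s1 = c1\<^sup>2 - 1" "s2 = c2\<^sup>2 - 1" "s3 = c3\<^sup>2 - 1"
    and w: "w1 * s1 = h1 * (1 - c1\<^sup>2) + h2 * (c1*c2 - c3) + h3 * (c1*c3 - c2)"
       "w2 * s2 = h2 * (1 - c2\<^sup>2) + h3 * (c2*c3 - c1) + h1 * (c2*c1 - c3)"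
       "w3 * s3 = h3 * (1 - c3\<^sup>2) + h1 * (c3*c1 - c2) + h2 * (c3*c2 - c1)"
begin

lemma rotate: "hyp_face e2 e3 e1 b c a r2 r3 r1 h2 h3 h1 c2 c3 c1 D s2 s3 s1 w2 w3 w1"
proof -
  interpret R: face_weights e2 e3 e1 b c a by (rule rotate)
  have c': "c2 = h3*h1 + b*(r3*r1)" "c3 = h2*h1 + c*(r2*r1)" "c1 = h2*h3 + a*(r2*r3)"
    by (simp_all add: c1 c2 c3 mult_ac)
  have D': "D = 1 + 2*c2*c3*c1 - c2\<^sup>2 - c3\<^sup>2 - c1\<^sup>2" unfolding D(1) by simp
  show ?thesis
    by unfold_locales (fact r h hr c' D' D(2) s w)+
qed

lemma cosh_gt_1: "c1 > 1" "c2 > 1" "c3 > 1"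
  unfolding c1 c2 c3
  by (rule cosh_edge_gt_1[OF eps(2,3) edge(1) r(2,3) h(2,3) hr(2,3)]
      cosh_edge_gt_1[OF eps(1,3) edge(2) r(1,3) h(1,3) hr(1,3)]
      cosh_edge_gt_1[OF eps(1,2) edge(3) r(1,2) h(1,2) hr(1,2)])+

lemma weight_eq:
  "w1 * s1 = r2*r3 * ((h1*r2*r3) * (e2*e3 - a\<^sup>2) + (h2*r1*r3) * (e3*c + a*b) + (h3*r1*r2) * (e2*b + a*c))"
proof -
  \<comment> \<open>Factors 1 are replaced by \<open>h2\<^sup>2 - e2*r2\<^sup>2\<close> and
    \<open>h3\<^sup>2 - e3*r3\<^sup>2\<close>. This makes the expression homogeneous in each pair of
    a height and a radius, and the claim becomes a polynomial identity without side
    relations.\<close>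
  have *: "1 - c1\<^sup>2 = (h2\<^sup>2 - e2*r2\<^sup>2) * (h3\<^sup>2 - e3*r3\<^sup>2) - c1\<^sup>2"
    "c1*c2 - c3 = c1*c2 - c3 * (h3\<^sup>2 - e3*r3\<^sup>2)" "c1*c3 - c2 = c1*c3 - c2 * (h2\<^sup>2 - e2*r2\<^sup>2)"
    by (simp_all add: hr)
  show ?thesis unfolding w * unfolding c1 c2 c3 by algebra
qed

text \<open>The left-hand sides are the partial derivatives of \<open>c1\<close>, \<open>c2\<close>,
  \<open>c3\<close> in the conformal coordinates; the brackets on the right are, up to positive
  factors, those of \<open>jacobian_pos\<close>.\<close>

lemma foot_eq:
  "h2*c1 - h3 = r2 * (e2*r2*h3 + a*r3*h2)" "h3*c1 - h2 = r3 * (e3*r3*h2 + a*r2*h3)"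
  "h3*c2 - h1 = r3 * (e3*r3*h1 + b*r1*h3)" "h1*c2 - h3 = r1 * (e1*r1*h3 + b*r3*h1)"
  "h1*c3 - h2 = r1 * (e1*r1*h2 + c*r2*h1)" "h2*c3 - h1 = r2 * (e2*r2*h1 + c*r1*h2)"
proof -
  have foot: "h*(h*h' + k) - h' = r * (e*r*h') + h * k" if "h\<^sup>2 = 1 + e * r\<^sup>2" for e r h h' k :: real
    using that by algebra
  show
    "h2*c1 - h3 = r2 * (e2*r2*h3 + a*r3*h2)" "h3*c1 - h2 = r3 * (e3*r3*h2 + a*r2*h3)"
    "h3*c2 - h1 = r3 * (e3*r3*h1 + b*r1*h3)" "h1*c2 - h3 = r1 * (e1*r1*h3 + b*r3*h1)"
    "h1*c3 - h2 = r1 * (e1*r1*h2 + c*r2*h1)" "h2*c3 - h1 = r2 * (e2*r2*h1 + c*r1*h2)"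
    using foot[OF hr(2), of h3 "a*(r2*r3)"] foot[OF hr(3), of h2 "a*(r2*r3)"]
      foot[OF hr(3), of h1 "b*(r1*r3)"] foot[OF hr(1), of h3 "b*(r1*r3)"]
      foot[OF hr(1), of h2 "c*(r1*r2)"] foot[OF hr(2), of h1 "c*(r1*r2)"]
    by (simp_all add: c1 c2 c3 algebra_simps)
qed

text \<open>Weights and partial derivatives are both linear in \<open>h1\<close>, \<open>h2\<close>,
  \<open>h3\<close>; eliminating these costs the factor \<open>D\<close>. The relation carries signs
  from the partial derivatives over to the weights.\<close>

lemma foot_weight:
  "D * (h2*c1 - h3) = s1 * ((c1*c3-c2)*w1 + s3*w3)"
  "D * (h3*c1 - h2) = s1 * ((c1*c2-c3)*w1 + s2*w2)"
  "D * (h3*c2 - h1) = s2 * (s1*w1 + (c1*c2-c3)*w2)"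
  "D * (h1*c2 - h3) = s2 * ((c2*c3-c1)*w2 + s3*w3)"
  "D * (h1*c3 - h2) = s3 * (s2*w2 + (c2*c3-c1)*w3)"
  "D * (h2*c3 - h1) = s3 * (s1*w1 + (c1*c3-c2)*w3)"
proof -
  have *: "s1 * ((c1*c3-c2)*w1 + s3*w3) = (c1*c3-c2)*(w1 * s1) + s1*(w3 * s3)"
    "s1 * ((c1*c2-c3)*w1 + s2*w2) = (c1*c2-c3)*(w1 * s1) + s1*(w2 * s2)"
    "s2 * (s1*w1 + (c1*c2-c3)*w2) = s2*(w1 * s1) + (c1*c2-c3)*(w2 * s2)"
    "s2 * ((c2*c3-c1)*w2 + s3*w3) = (c2*c3-c1)*(w2 * s2) + s2*(w3 * s3)"
    "s3 * (s2*w2 + (c2*c3-c1)*w3) = s3*(w2 * s2) + (c2*c3-c1)*(w3 * s3)"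
    "s3 * (s1*w1 + (c1*c3-c2)*w3) = s3*(w1 * s1) + (c1*c3-c2)*(w3 * s3)"
    by (simp_all add: algebra_simps)
  show
  "D * (h2*c1 - h3) = s1 * ((c1*c3-c2)*w1 + s3*w3)"
  "D * (h3*c1 - h2) = s1 * ((c1*c2-c3)*w1 + s2*w2)"
  "D * (h3*c2 - h1) = s2 * (s1*w1 + (c1*c2-c3)*w2)"
  "D * (h1*c2 - h3) = s2 * ((c2*c3-c1)*w2 + s3*w3)"
  "D * (h1*c3 - h2) = s3 * (s2*w2 + (c2*c3-c1)*w3)"
  "D * (h2*c3 - h1) = s3 * (s1*w1 + (c1*c3-c2)*w3)"
  unfolding * w unfolding D s by algebra+
qed

text \<open>\<open>B\<close> is the Jacobian determinant of the three cosines. It is positive by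
  \<open>jacobian_pos\<close>, and \<open>foot_weight\<close> together with
  \<open>hyp_det_identity\<close> turns \<open>D ^ 3 * B\<close> into a positive multiple of the
  determinant of the form.\<close>

lemma det_form_pos:
  "2*(c1*c2*c3-1)*w1*w2*w3 + w1\<^sup>2 * (c1\<^sup>2-1) * (c2*w2+c3*w3)
      + w2\<^sup>2 * (c2\<^sup>2-1) * (c1*w1+c3*w3) + w3\<^sup>2 * (c3\<^sup>2-1) * (c1*w1+c2*w2) > 0" (is "?det > 0")
proof -
  define B where "B = (h2*c1 - h3) * (h3*c2 - h1) * (h1*c3 - h2) + (h3*c1 - h2) * (h1*c2 - h3) * (h2*c3 - h1)"
  have s_pos: "s1 > 0" "s2 > 0" "s3 > 0" using cosh_gt_1 unfolding s by (simp_all add: power2_gt_1_iff)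
  have "0 < (e2*(r2*h1*h3) + a*(r3*h1*h2)) * (e3*(r3*h1*h2) + b*(r1*h2*h3)) * (e1*(r1*h2*h3) + c*(r2*h1*h3)) +
         (e3*(r3*h1*h2) + a*(r2*h1*h3)) * (e1*(r1*h2*h3) + b*(r3*h1*h2)) * (e2*(r2*h1*h3) + c*(r1*h2*h3))"
    using r h by (intro jacobian_pos) auto
  then have "0 < (r1*r2*r3) * \<dots>" using r by simp
  also have "\<dots> = (h1*h2*h3) * B" unfolding B_def foot_eq by algebra
  finally have "B > 0" by (rule zero_less_mult_pos) (use h in simp)
  then have "0 < D ^ 3 * B" using D(2) by simp
  also have "\<dots> = (D * (h2*c1 - h3)) * (D * (h3*c2 - h1)) * (D * (h1*c3 - h2)) +
     (D * (h3*c1 - h2)) * (D * (h1*c2 - h3)) * (D * (h2*c3 - h1))"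
    unfolding B_def by algebra
  also have "\<dots> = (s1 * s2 * s3) * (((c1*c3-c2)*w1 + s3*w3) * (s1*w1 + (c1*c2-c3)*w2) * (s2*w2 + (c2*c3-c1)*w3)
     + ((c1*c2-c3)*w1 + s2*w2) * ((c2*c3-c1)*w2 + s3*w3) * (s1*w1 + (c1*c3-c2)*w3))"
    unfolding foot_weight by algebra
  also have "\<dots> = (s1 * s2 * s3) * D * ?det"
    unfolding hyp_det_identity[OF s] D(1) unfolding s by (simp only: mult.assoc)
  finally show ?thesis by (rule zero_less_mult_pos) (use s_pos D(2) in simp)
qed

lemma weight_neg_imp:
  assumes "w1 < 0"
  shows "a > 0" "w2 \<ge> 0"
proof -
  interpret R: hyp_face e2 e3 e1 b c a r2 r3 r1 h2 h3 h1 c2 c3 c1 D s2 s3 s1 w2 w3 w1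
    by (rule rotate)
  have s_pos: "s1 > 0" "s2 > 0" using cosh_gt_1 unfolding s by (simp_all add: power2_gt_1_iff)
  let ?H = "(h1*r2*r3) * (e2*e3 - a\<^sup>2) + (h2*r1*r3) * (e3*c + a*b) + (h3*r1*r2) * (e2*b + a*c)"
  have "r2*r3 * ?H < 0" using assms s_pos weight_eq by (metis mult_neg_pos)
  then have neg: "?H < 0" using r by (simp add: mult_less_0_iff zero_less_mult_iff)
  have x: "h1*r2*r3 > 0" "h2*r1*r3 > 0" "h3*r1*r2 > 0" using r h by auto
  show "a > 0" by (rule height_neg_imp[OF x neg])
  have "w2 * s2 \<ge> 0" unfolding R.weight_eq
    using height_not_both_neg[OF x neg] r by (intro mult_nonneg_nonneg) (auto simp: mult_ac add_ac)
  then show "w2 \<ge> 0" using s_pos by (simp add: zero_le_mult_iff)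
qed

text \<open>If \<open>w3\<close> is negative then \<open>c > 0\<close>, hence both partial
  derivatives of \<open>c3\<close> are positive. By \<open>foot_weight\<close> these are the two
  conditions \<open>q\<close> of \<open>form_pos_of_one_neg\<close>.\<close>

lemma form_pos_aux:
  assumes "w1 \<ge> 0" "w2 \<ge> 0" "\<not> (d1 = 0 \<and> d2 = 0 \<and> d3 = 0)"
  shows "w1 * (c1*(d2\<^sup>2+d3\<^sup>2) - 2*d2*d3) + w2 * (c2*(d3\<^sup>2+d1\<^sup>2) - 2*d3*d1)
          + w3 * (c3*(d1\<^sup>2+d2\<^sup>2) - 2*d1*d2) > 0"
proof (cases "w3 \<ge> 0")
  case True
  then show ?thesis using cosh_gt_1 det_form_pos assms by (intro form_pos_of_nonneg)
next
  case False
  interpret R: hyp_face e2 e3 e1 b c a r2 r3 r1 h2 h3 h1 c2 c3 c1 D s2 s3 s1 w2 w3 w1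
    by (rule rotate)
  interpret RR: hyp_face e3 e1 e2 c a b r3 r1 r2 h3 h1 h2 c3 c1 c2 D s3 s1 s2 w3 w1 w2
    by (rule R.rotate)
  have "c > 0" using RR.weight_neg_imp False by simp
  have s_pos: "s3 > 0" using cosh_gt_1 unfolding s by (simp add: power2_gt_1_iff)
  have "e1 \<ge> 0" "e2 \<ge> 0" using eps by auto
  then have "h1*c3 - h2 > 0" "h2*c3 - h1 > 0" unfolding foot_eq using r h \<open>c > 0\<close>
    by (auto intro!: mult_pos_pos add_nonneg_pos)
  then have "D * (h1*c3 - h2) > 0" "D * (h2*c3 - h1) > 0" using D(2) by simp_all
  then have "s2*w2 + (c2*c3-c1)*w3 > 0" "s1*w1 + (c1*c3-c2)*w3 > 0"
    unfolding foot_weight using s_pos by (simp_all add: zero_less_mult_iff)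
  then show ?thesis using cosh_gt_1 det_form_pos assms unfolding s by (intro form_pos_of_one_neg)
qed

lemma form_pos:
  assumes "\<not> (d1 = 0 \<and> d2 = 0 \<and> d3 = 0)"
  shows "w1 * (c1*(d2\<^sup>2+d3\<^sup>2) - 2*d2*d3) + w2 * (c2*(d3\<^sup>2+d1\<^sup>2) - 2*d3*d1)
          + w3 * (c3*(d1\<^sup>2+d2\<^sup>2) - 2*d1*d2) > 0"
proof -
  interpret R: hyp_face e2 e3 e1 b c a r2 r3 r1 h2 h3 h1 c2 c3 c1 D s2 s3 s1 w2 w3 w1
    by (rule rotate)
  interpret RR: hyp_face e3 e1 e2 c a b r3 r1 r2 h3 h1 h2 c3 c1 c2 D s3 s1 s2 w3 w1 w2
    by (rule R.rotate)
  consider "w1 \<ge> 0" "w2 \<ge> 0" | "w2 \<ge> 0" "w3 \<ge> 0" | "w3 \<ge> 0" "w1 \<ge> 0"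
    using weight_neg_imp R.weight_neg_imp RR.weight_neg_imp by linarith
  then show ?thesis
  proof cases
    case 1
    then show ?thesis using assms by (intro form_pos_aux)
  next
    case 2
    then have "w2 * (c2*(d3\<^sup>2+d1\<^sup>2) - 2*d3*d1) + w3 * (c3*(d1\<^sup>2+d2\<^sup>2) - 2*d1*d2)
      + w1 * (c1*(d2\<^sup>2+d3\<^sup>2) - 2*d2*d3) > 0" using assms by (intro R.form_pos_aux) auto
    then show ?thesis by (simp only: add_ac)
  next
    case 3
    then have "w3 * (c3*(d1\<^sup>2+d2\<^sup>2) - 2*d1*d2) + w1 * (c1*(d2\<^sup>2+d3\<^sup>2) - 2*d2*d3)
      + w2 * (c2*(d3\<^sup>2+d1\<^sup>2) - 2*d3*d1) > 0" using assms by (intro RR.form_pos_aux) auto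
    then show ?thesis by (simp only: add_ac)
  qed
qed

lemma angle_form_neg:
  fixes d1 d2 d3
  defines "E1 \<equiv> (h2*c1-h3)*d2 + (h3*c1-h2)*d3"
      and "E2 \<equiv> (h3*c2-h1)*d3 + (h1*c2-h3)*d1"
      and "E3 \<equiv> (h1*c3-h2)*d1 + (h2*c3-h1)*d2"
  assumes "\<not> (d1 = 0 \<and> d2 = 0 \<and> d3 = 0)"
  shows "d1 * (E1 - (c2*c1-c3)/s2*E2 - (c3*c1-c2)/s3*E3)
       + d2 * (E2 - (c3*c2-c1)/s3*E3 - (c1*c2-c3)/s1*E1)
       + d3 * (E3 - (c1*c3-c2)/s1*E1 - (c2*c3-c1)/s2*E2) < 0"
proof -
  have s_pos: "s1 > 0" "s2 > 0" "s3 > 0" using cosh_gt_1 unfolding s by (simp_all add: power2_gt_1_iff)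
  then have "s1 \<noteq> 0" "s2 \<noteq> 0" "s3 \<noteq> 0" by auto
  from hyp_angle_form[OF s this w, of d1 d2 d3] form_pos[OF assms(4)]
  show ?thesis unfolding E1_def E2_def E3_def by linarith
qed

end

section \<open>The quadratic form of a Euclidean face\<close>

lemma euc_edge_pos:
  fixes e e' :: real
  assumes "e \<in> {0,1}" "e' \<in> {0,1}" "e * e' + a > 0" "r > 0" "r' > 0"
  shows "e * r\<^sup>2 + e' * r'\<^sup>2 + 2 * a * (r * r') > 0"
proof -
  have "e * e' * (2 * r * r') \<le> e * r\<^sup>2 + e' * r'\<^sup>2"
    using sum_squares_bound[of r r'] assms by auto
  moreover have "2 * ((e * e' + a) * (r * r')) > 0" using assms by simp
  ultimately show ?thesis by (simp add: algebra_simps)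
qed

lemma euc_foot_quotient:
  fixes L L' L'' s s' s'' w d d' :: real
  assumes "L \<noteq> 0" "w * L = L * (L' + L'' - L) - 2 * L * s + s' * (L + L' - L'') + s'' * (L + L'' - L')"
  shows "(L + L' - L'') / (2*L) * ((L + s' - s'') * d + (L + s'' - s') * d') =
    (L - L'' - s'' + s + w/2) * d + (L' + s'' - s - w/2) * d'"
proof -
  have "(L + L' - L'') * (L + s' - s'') = (2*L) * (L - L'' - s'' + s + w/2)"
    "(L + L' - L'') * (L + s'' - s') = (2*L) * (L' + s'' - s - w/2)"
    using assms(2) by (simp_all add: algebra_simps)
  then have "(L + L' - L'') / (2*L) * (L + s' - s'') = L - L'' - s'' + s + w/2"
    "(L + L' - L'') / (2*L) * (L + s'' - s') = L' + s'' - s - w/2"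
    using assms(1) by simp_all
  then show ?thesis by (simp add: distrib_left flip: mult.assoc)
qed

text \<open>Here \<open>E1\<close>, \<open>E2\<close>, \<open>E3\<close> are derivatives of squared
  lengths, and each bracket is again an angle derivative times the square root of the discriminant.
  Only differences of \<open>d1\<close>, \<open>d2\<close>, \<open>d3\<close> survive because
  scaling preserves angles.\<close>

lemma euc_angle_form:
  fixes L1 L2 L3 d1 d2 d3 s1 s2 s3 :: real
  defines "E1 \<equiv> (L1+s2-s3)*d2 + (L1+s3-s2)*d3"
      and "E2 \<equiv> (L2+s3-s1)*d3 + (L2+s1-s3)*d1"
      and "E3 \<equiv> (L3+s1-s2)*d1 + (L3+s2-s1)*d2"
  assumes L: "L1 \<noteq> 0" "L2 \<noteq> 0" "L3 \<noteq> 0"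
    and w: "w1 * L1 = L1 * (L2 + L3 - L1) - 2 * L1 * s1 + s2 * (L1 + L2 - L3) + s3 * (L1 + L3 - L2)"
       "w2 * L2 = L2 * (L3 + L1 - L2) - 2 * L2 * s2 + s3 * (L2 + L3 - L1) + s1 * (L2 + L1 - L3)"
       "w3 * L3 = L3 * (L1 + L2 - L3) - 2 * L3 * s3 + s1 * (L3 + L1 - L2) + s2 * (L3 + L2 - L1)"
  shows "d1 * (E1 - (L2+L1-L3)/(2*L2)*E2 - (L3+L1-L2)/(2*L3)*E3)
       + d2 * (E2 - (L3+L2-L1)/(2*L3)*E3 - (L1+L2-L3)/(2*L1)*E1)
       + d3 * (E3 - (L1+L3-L2)/(2*L1)*E1 - (L2+L3-L1)/(2*L2)*E2)
     = - (w1 * (d2-d3)\<^sup>2 + w2 * (d3-d1)\<^sup>2 + w3 * (d1-d2)\<^sup>2) / 2"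
proof -
  have 1: "(L2+L1-L3)/(2*L2)*E2 = (L2 - L3 - s3 + s2 + w2/2) * d1 + (L1 + s3 - s2 - w2/2) * d3"
    using euc_foot_quotient[OF L(2), of w2 L1 L3 s2 s1 s3 d1 d3] w(2) by (simp add: E2_def add_ac)
  have 2: "(L3+L1-L2)/(2*L3)*E3 = (L3 - L2 - s2 + s3 + w3/2) * d1 + (L1 + s2 - s3 - w3/2) * d2"
    using euc_foot_quotient[OF L(3), of w3 L1 L2 s3 s1 s2 d1 d2] w(3) by (simp add: E3_def add_ac)
  have 3: "(L3+L2-L1)/(2*L3)*E3 = (L3 - L1 - s1 + s3 + w3/2) * d2 + (L2 + s1 - s3 - w3/2) * d1"
    using euc_foot_quotient[OF L(3), of w3 L2 L1 s3 s2 s1 d2 d1] w(3) by (simp add: E3_def add_ac)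
  have 4: "(L1+L2-L3)/(2*L1)*E1 = (L1 - L3 - s3 + s1 + w1/2) * d2 + (L2 + s3 - s1 - w1/2) * d3"
    using euc_foot_quotient[OF L(1), of w1 L2 L3 s1 s2 s3 d2 d3] w(1) by (simp add: E1_def add_ac)
  have 5: "(L1+L3-L2)/(2*L1)*E1 = (L1 - L2 - s2 + s1 + w1/2) * d3 + (L3 + s2 - s1 - w1/2) * d2"
    using euc_foot_quotient[OF L(1), of w1 L3 L2 s1 s3 s2 d3 d2] w(1) by (simp add: E1_def add_ac)
  have 6: "(L2+L3-L1)/(2*L2)*E2 = (L2 - L1 - s1 + s2 + w2/2) * d3 + (L3 + s1 - s2 - w2/2) * d1"
    using euc_foot_quotient[OF L(2), of w2 L3 L1 s2 s3 s1 d3 d1] w(2) by (simp add: E2_def add_ac)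
  have half: "x = - y / 2" if "2 * x = - y" for x y :: real using that by simp
  show ?thesis unfolding 1 2 3 4 5 6 unfolding E1_def E2_def E3_def
    by (rule half) (simp add: algebra_simps power2_eq_square)
qed

text \<open>Since scaling lies in the kernel, the 2x2 minor \<open>w1*w2 + w2*w3 + w3*w1\<close>
  replaces the determinant. The last factor is the Jacobian determinant of the squared lengths, for
  which scaling is not a kernel direction.\<close>

lemma euc_det_identity:
  fixes L1 L2 L3 s1 s2 s3 :: real
  assumes w: "w1 * L1 = L1 * (L2 + L3 - L1) - 2 * L1 * s1 + s2 * (L1 + L2 - L3) + s3 * (L1 + L3 - L2)"
       "w2 * L2 = L2 * (L3 + L1 - L2) - 2 * L2 * s2 + s3 * (L2 + L3 - L1) + s1 * (L2 + L1 - L3)"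
       "w3 * L3 = L3 * (L1 + L2 - L3) - 2 * L3 * s3 + s1 * (L3 + L1 - L2) + s2 * (L3 + L2 - L1)"
  shows "2 * (L1*L2*L3) * (w1*w2 + w2*w3 + w3*w1) = (2*(L1*L2 + L2*L3 + L3*L1) - L1\<^sup>2 - L2\<^sup>2 - L3\<^sup>2) *
    ((L1+s2-s3) * (L2+s3-s1) * (L3+s1-s2) + (L1+s3-s2) * (L2+s1-s3) * (L3+s2-s1))"
proof -
  have "2 * (L1*L2*L3) * (w1*w2 + w2*w3 + w3*w1)
    = 2 * (L3 * (w1 * L1) * (w2 * L2) + L1 * (w2 * L2) * (w3 * L3) + L2 * (w3 * L3) * (w1 * L1))"
    by algebra
  then show ?thesis unfolding w by algebra
qed

text \<open>\<open>Li\<close> is the squared length of the side opposite to vertex \<open>i\<close>, and \<open>D\<close> is 16 times the squared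
  area.\<close>

locale euc_face = face_weights +
  fixes r1 r2 r3 D w1 w2 w3 L1 L2 L3 s1 s2 s3 :: real
  assumes r: "r1 > 0" "r2 > 0" "r3 > 0"
    and L1: "L1 = e2 * r2\<^sup>2 + e3 * r3\<^sup>2 + 2 * a * (r2 * r3)" and L2: "L2 = e1 * r1\<^sup>2 + e3 * r3\<^sup>2 + 2 * b * (r1 * r3)"
    and L3: "L3 = e1 * r1\<^sup>2 + e2 * r2\<^sup>2 + 2 * c * (r1 * r2)"
    and s: "s1 = e1 * r1\<^sup>2" "s2 = e2 * r2\<^sup>2" "s3 = e3 * r3\<^sup>2"
    and D: "D = 2*(L1*L2 + L2*L3 + L3*L1) - L1\<^sup>2 - L2\<^sup>2 - L3\<^sup>2" "D > 0"
    and w: "w1 * L1 = L1 * (L2 + L3 - L1) - 2 * L1 * s1 + s2 * (L1 + L2 - L3) + s3 * (L1 + L3 - L2)"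
       "w2 * L2 = L2 * (L3 + L1 - L2) - 2 * L2 * s2 + s3 * (L2 + L3 - L1) + s1 * (L2 + L1 - L3)"
       "w3 * L3 = L3 * (L1 + L2 - L3) - 2 * L3 * s3 + s1 * (L3 + L1 - L2) + s2 * (L3 + L2 - L1)"
begin

lemma rotate: "euc_face e2 e3 e1 b c a r2 r3 r1 D w2 w3 w1 L2 L3 L1 s2 s3 s1"
proof -
  interpret R: face_weights e2 e3 e1 b c a by (rule rotate)
  have L': "L2 = e3 * r3\<^sup>2 + e1 * r1\<^sup>2 + 2 * b * (r3 * r1)" "L3 = e2 * r2\<^sup>2 + e1 * r1\<^sup>2 + 2 * c * (r2 * r1)"
    by (simp_all add: L2 L3 mult_ac add_ac)
  have D': "D = 2*(L2*L3 + L3*L1 + L1*L2) - L2\<^sup>2 - L3\<^sup>2 - L1\<^sup>2" unfolding D(1) by simp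
  show ?thesis
    by unfold_locales (fact r L1 L' s D' D(2) w)+
qed

lemma L_pos: "L1 > 0" "L2 > 0" "L3 > 0"
  unfolding L1 L2 L3
  by (rule euc_edge_pos[OF eps(2,3) edge(1) r(2,3)] euc_edge_pos[OF eps(1,3) edge(2) r(1,3)]
      euc_edge_pos[OF eps(1,2) edge(3) r(1,2)])+

lemma weight_eq:
  "w1 * L1 = 4 * (r2*r3) * ((r2*r3) * (e2*e3 - a\<^sup>2) + (r1*r3) * (e3*c + a*b) + (r1*r2) * (e2*b + a*c))"
  unfolding w unfolding s L1 L2 L3 by algebra

lemma weight_neg_imp:
  assumes "w1 < 0"
  shows "w2 \<ge> 0"
proof -
  interpret R: euc_face e2 e3 e1 b c a r2 r3 r1 D w2 w3 w1 L2 L3 L1 s2 s3 s1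
    by (rule rotate)
  let ?H = "(r2*r3) * (e2*e3 - a\<^sup>2) + (r1*r3) * (e3*c + a*b) + (r1*r2) * (e2*b + a*c)"
  have "4*(r2*r3) * ?H < 0" using assms L_pos weight_eq by (metis mult_neg_pos)
  then have neg: "?H < 0" using r by (simp add: mult_less_0_iff zero_less_mult_iff)
  have x: "r2*r3 > 0" "r1*r3 > 0" "r1*r2 > 0" using r by auto
  have "w2 * L2 \<ge> 0" unfolding R.weight_eq
    using height_not_both_neg[OF x neg] r by (intro mult_nonneg_nonneg) (auto simp: mult_ac add_ac)
  then show "w2 \<ge> 0" using L_pos by (simp add: zero_le_mult_iff)
qed

lemma det_form_pos: "w1*w2 + w2*w3 + w3*w1 > 0"
proof -
  have "0 < (e2*r2 + a*r3) * (e3*r3 + b*r1) * (e1*r1 + c*r2) + (e3*r3 + a*r2) * (e1*r1 + b*r3) * (e2*r2 + c*r1)"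
    using r by (intro jacobian_pos)
  then have "0 < (D * (8*r1*r2*r3)) * \<dots>" using r D(2) by simp
  also have "\<dots> = 2 * (L1*L2*L3) * (w1*w2 + w2*w3 + w3*w1)"
  proof -
    have *: "L1+s2-s3 = 2*r2*(e2*r2 + a*r3)" "L1+s3-s2 = 2*r3*(e3*r3 + a*r2)"
      "L2+s3-s1 = 2*r3*(e3*r3 + b*r1)" "L2+s1-s3 = 2*r1*(e1*r1 + b*r3)"
      "L3+s1-s2 = 2*r1*(e1*r1 + c*r2)" "L3+s2-s1 = 2*r2*(e2*r2 + c*r1)"
      unfolding L1 L2 L3 s by algebra+
    show ?thesis unfolding euc_det_identity[OF w] D(1)[symmetric] * by algebra
  qed
  finally show ?thesis by (rule zero_less_mult_pos) (use L_pos in simp)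
qed

lemma form_pos_aux:
  assumes "w1 \<ge> 0" "w2 \<ge> 0" "\<not> (d1 = d2 \<and> d2 = d3)"
  shows "w1 * (d2-d3)\<^sup>2 + w2 * (d3-d1)\<^sup>2 + w3 * (d1-d2)\<^sup>2 > 0" (is "?Q > 0")
proof (rule ccontr)
  assume Q: "\<not> ?Q > 0"
  have "w1 > 0 \<or> w2 > 0" using det_form_pos assms by (auto simp: less_le)
  then have pos: "w1 + w2 > 0" using assms by linarith
  \<comment> \<open>Completes the square in \<open>d3\<close>, whose square has coefficient
    \<open>w1 + w2\<close>; the sign of \<open>w3\<close> matters only through the minor.\<close>
  have "(w1 + w2) * ?Q = (w1*w2 + w2*w3 + w3*w1) * (d1-d2)\<^sup>2 + (w1 * (d2-d3) - w2 * (d3-d1))\<^sup>2"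
    by algebra
  moreover have "(w1 + w2) * ?Q \<le> 0" using Q pos by (intro mult_nonneg_nonpos) auto
  moreover have "(w1*w2 + w2*w3 + w3*w1) * (d1-d2)\<^sup>2 \<ge> 0" using det_form_pos by simp
  moreover have "(w1 * (d2-d3) - w2 * (d3-d1))\<^sup>2 \<ge> 0" by simp
  ultimately have "(w1*w2 + w2*w3 + w3*w1) * (d1-d2)\<^sup>2 = 0" "(w1 * (d2-d3) - w2 * (d3-d1))\<^sup>2 = 0"
    by linarith+
  then have "d1 = d2" "w1 * (d2-d3) = w2 * (d3-d1)" using det_form_pos by auto
  then have "(w1 + w2) * (d2 - d3) = 0" by (simp add: algebra_simps)
  with pos \<open>d1 = d2\<close> assms(3) show False by simp
qed

lemma form_pos:
  assumes "\<not> (d1 = d2 \<and> d2 = d3)"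
  shows "w1 * (d2-d3)\<^sup>2 + w2 * (d3-d1)\<^sup>2 + w3 * (d1-d2)\<^sup>2 > 0"
proof -
  interpret R: euc_face e2 e3 e1 b c a r2 r3 r1 D w2 w3 w1 L2 L3 L1 s2 s3 s1
    by (rule rotate)
  interpret RR: euc_face e3 e1 e2 c a b r3 r1 r2 D w3 w1 w2 L3 L1 L2 s3 s1 s2
    by (rule R.rotate)
  consider "w1 \<ge> 0" "w2 \<ge> 0" | "w2 \<ge> 0" "w3 \<ge> 0" | "w3 \<ge> 0" "w1 \<ge> 0"
    using weight_neg_imp R.weight_neg_imp RR.weight_neg_imp by linarith
  then show ?thesis
  proof cases
    case 1
    then show ?thesis using assms by (intro form_pos_aux)
  next
    case 2
    then have "w2 * (d3-d1)\<^sup>2 + w3 * (d1-d2)\<^sup>2 + w1 * (d2-d3)\<^sup>2 > 0"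
      using assms by (intro R.form_pos_aux) auto
    then show ?thesis by (simp only: add_ac)
  next
    case 3
    then have "w3 * (d1-d2)\<^sup>2 + w1 * (d2-d3)\<^sup>2 + w2 * (d3-d1)\<^sup>2 > 0"
      using assms by (intro RR.form_pos_aux) auto
    then show ?thesis by (simp only: add_ac)
  qed
qed

lemma angle_form_neg:
  fixes d1 d2 d3
  defines "E1 \<equiv> (L1+s2-s3)*d2 + (L1+s3-s2)*d3"
      and "E2 \<equiv> (L2+s3-s1)*d3 + (L2+s1-s3)*d1"
      and "E3 \<equiv> (L3+s1-s2)*d1 + (L3+s2-s1)*d2"
  assumes "\<not> (d1 = d2 \<and> d2 = d3)"
  shows "d1 * (E1 - (L2+L1-L3)/(2*L2)*E2 - (L3+L1-L2)/(2*L3)*E3)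
       + d2 * (E2 - (L3+L2-L1)/(2*L3)*E3 - (L1+L2-L3)/(2*L1)*E1)
       + d3 * (E3 - (L1+L3-L2)/(2*L1)*E1 - (L2+L3-L1)/(2*L2)*E2) < 0"
proof -
  have "L1 \<noteq> 0" "L2 \<noteq> 0" "L3 \<noteq> 0" using L_pos by auto
  note form = euc_angle_form[OF this w, of d1 d2 d3]
  have neg: "x < 0" if "x = - y / 2" "y > 0" for x y :: real using that by simp
  show ?thesis unfolding E1_def E2_def E3_def by (rule neg[OF form form_pos[OF assms(4)]])
qed

end

section \<open>Monotonicity of the continued angles\<close>

text \<open>If the function ended higher, it would cross a level \<open>y\<close> outside
  \<open>S\<close>. At the last time with value at most \<open>y\<close> the value is
  \<open>y\<close>, and the negative derivative there produces a later such time.\<close>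

lemma nonincreasing_off_finite:
  fixes \<phi> :: "real \<Rightarrow> real"
  assumes "continuous_on {a..b} \<phi>" "finite S" "a \<le> b"
    and deriv: "\<And>t. a \<le> t \<Longrightarrow> t < b \<Longrightarrow> \<phi> t \<notin> S \<Longrightarrow> \<exists>D<0. (\<phi> has_real_derivative D) (at t)"
  shows "\<phi> b \<le> \<phi> a"
proof (rule ccontr)
  assume "\<not> ?thesis"
  then have "\<phi> a < \<phi> b" by simp
  then have "infinite {\<phi> a<..<\<phi> b}" by (rule infinite_Ioo)
  then obtain y where y: "\<phi> a < y" "y < \<phi> b" "y \<notin> S"
    using \<open>finite S\<close> by (metis greaterThanLessThan_iff rev_finite_subset subsetI)
  let ?A = "{a..b} \<inter> \<phi> -` {..y}"
  have "closed ?A" using assms(1) by (intro continuous_closed_preimage) auto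
  then have "compact ?A" using compact_Int_closed[of "{a..b}" ?A] by (simp add: Int_absorb1)
  moreover have "a \<in> ?A" using y assms(3) by auto
  ultimately obtain t where t: "t \<in> ?A" and max: "\<And>x. x \<in> ?A \<Longrightarrow> x \<le> t"
    using compact_attains_sup[of ?A] by blast
  have "t < b" using t y by (cases "t = b") auto
  have "\<phi> t = y"
  proof -
    have "continuous_on {t..b} \<phi>" using assms(1) t by (auto intro: continuous_on_subset)
    then obtain x where x: "t \<le> x" "x \<le> b" "\<phi> x = y"
      using IVT'[of \<phi> t y b] t y \<open>t < b\<close> by auto
    then have "x \<le> t" using t by (intro max) auto
    with x show ?thesis by simp
  qed
  then obtain D where "D < 0" "(\<phi> has_real_derivative D) (at t)"
    using deriv[of t] t \<open>t < b\<close> y by auto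
  then obtain d where d: "d > 0" "\<And>h. 0 < h \<Longrightarrow> h < d \<Longrightarrow> \<phi> (t + h) < \<phi> t"
    using DERIV_neg_dec_right by blast
  define h where "h = min (d/2) (b - t)"
  have "0 < h" "h < d" "t + h \<le> b" using d \<open>t < b\<close> unfolding h_def by auto
  then have "t + h \<le> t" using d(2)[of h] t \<open>\<phi> t = y\<close> by (intro max) auto
  then show False using \<open>0 < h\<close> by simp
qed

text \<open>With \<open>N / sqrt G\<close> the cosine from the law of cosines, this continues the angle continuously to
  lengths that violate the triangle inequality.\<close>

definition clamped_angle :: "real \<Rightarrow> real \<Rightarrow> real" where
  "clamped_angle N G = arccos (max (- 1) (min 1 (N / sqrt G)))"

lemma clamped_angle_eq: "clamped_angle N G = arccos (N / sqrt G)" if "\<bar>N / sqrt G\<bar> \<le> 1"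
proof -
  have "- 1 \<le> N / sqrt G" "N / sqrt G \<le> 1" using that by linarith+
  then show ?thesis unfolding clamped_angle_def by (simp only: min_absorb2 max_absorb2)
qed

text \<open>Source of the finite set of values: at or beyond a degenerate triangle the cosine is
  clamped to 1 or -1.\<close>

lemma clamped_angle_degenerate:
  assumes "G > 0" "N\<^sup>2 \<ge> G"
  shows "clamped_angle N G \<in> {0, pi}"
proof -
  have "sqrt G \<le> \<bar>N\<bar>" using assms real_le_rsqrt real_sqrt_le_mono by fastforce
  then have "1 \<le> \<bar>N / sqrt G\<bar>" using assms by (simp add: abs_divide)
  then have "N / sqrt G \<ge> 1 \<or> N / sqrt G \<le> - 1" by linarith
  then show ?thesis unfolding clamped_angle_def by (auto simp: min_absorb1 min_absorb2 max_absorb1)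
qed

lemma abs_quotient_less_1: "\<bar>N / sqrt G\<bar> < 1" if "N\<^sup>2 < G" "G > 0" for N G :: real
proof -
  have "\<bar>N\<bar> < sqrt G" using that by (metis real_sqrt_abs real_sqrt_less_mono)
  then show ?thesis using that by (simp add: abs_divide)
qed

lemma continuous_on_clamped_angle:
  assumes "continuous_on S N" "continuous_on S G" "\<And>t. t \<in> S \<Longrightarrow> G t > 0"
  shows "continuous_on S (\<lambda>t. clamped_angle (N t) (G t))"
  unfolding clamped_angle_def
  by (intro continuous_intros assms ballI) (auto dest: assms(3))

lemma DERIV_clamped_angle:
  assumes N: "(N has_real_derivative N') (at t)" and G: "(G has_real_derivative G') (at t)"
    and G0: "G t > 0" and D: "(N t)\<^sup>2 < G t"
  shows "((\<lambda>t. clamped_angle (N t) (G t)) has_real_derivative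
          - (N' - N t * G' / (2 * G t)) / sqrt (G t - (N t)\<^sup>2)) (at t)"
proof -
  let ?C = "\<lambda>t. N t / sqrt (G t)"
  have C: "\<bar>?C t\<bar> < 1" using abs_quotient_less_1 D G0 by blast
  let ?C' = "(N' - N t * G' / (2 * G t)) / sqrt (G t)"
  have sq: "sqrt (G t) * sqrt (G t) = G t" "sqrt (G t) > 0" using G0 by auto
  have dC: "(?C has_real_derivative ?C') (at t)"
    using G0
    by (auto intro!: derivative_eq_intros N G simp: divide_simps power2_eq_square)
  have dA: "(arccos has_real_derivative inverse (- sqrt (1 - (?C t)\<^sup>2))) (at (?C t))"
    by (intro DERIV_arccos) (use C in linarith)+
  have "((\<lambda>t. arccos (?C t)) has_real_derivative inverse (- sqrt (1 - (?C t)\<^sup>2)) * ?C') (at t)"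
    using DERIV_chain2[OF dA dC] .
  moreover have "inverse (- sqrt (1 - (?C t)\<^sup>2)) * ?C' = - (N' - N t * G' / (2 * G t)) / sqrt (G t - (N t)\<^sup>2)"
  proof -
    have "1 - (?C t)\<^sup>2 = (G t - (N t)\<^sup>2) / G t" using G0 by (simp add: power_divide diff_divide_distrib)
    then have "sqrt (1 - (?C t)\<^sup>2) = sqrt (G t - (N t)\<^sup>2) / sqrt (G t)" by (simp add: real_sqrt_divide)
    then show ?thesis using sq(2) by (simp add: divide_simps)
  qed
  \<comment> \<open>The cosine at \<open>t\<close> lies strictly between -1 and 1, so the clamp is
    inactive in a neighbourhood.\<close>
  moreover have "\<forall>\<^sub>F x in nhds t. clamped_angle (N x) (G x) = arccos (?C x)"
  proof -
    have "isCont ?C t" using dC DERIV_isCont by blast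
    then have "isCont (\<lambda>x. \<bar>?C x\<bar>) t" by (rule continuous_rabs)
    then have "(\<lambda>x. \<bar>?C x\<bar>) \<midarrow>t\<rightarrow> \<bar>?C t\<bar>" by (simp add: isCont_def)
    then have "\<forall>\<^sub>F x in at t. \<bar>?C x\<bar> < 1" using C by (rule order_tendstoD)
    then have "\<forall>\<^sub>F x in nhds t. \<bar>?C x\<bar> < 1" using C by (auto simp: eventually_nhds_conv_at)
    then show "\<forall>\<^sub>F x in nhds t. clamped_angle (N x) (G x) = arccos (?C x)"
      by (rule eventually_mono) (rule clamped_angle_eq, simp)
  qed
  ultimately show ?thesis by (subst DERIV_cong_ev[OF refl _ refl]) auto
qed

text \<open>The common discriminant \<open>D\<close> does two things. Where it is positive, the
  three derivatives have the same denominator \<open>sqrt D\<close>, so \<open>neg\<close> speaks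
  only of numerators. Where it is not, all three angles are 0 or \<open>pi\<close>, so the weighted
  sum has at most eight values.\<close>

lemma angle_sum_decreasing:
  fixes N1 N2 N3 G1 G2 G3 D :: "real \<Rightarrow> real"
  assumes N: "\<And>t. t \<in> {0..1} \<Longrightarrow> (N1 has_real_derivative N1' t) (at t)"
      "\<And>t. t \<in> {0..1} \<Longrightarrow> (N2 has_real_derivative N2' t) (at t)"
      "\<And>t. t \<in> {0..1} \<Longrightarrow> (N3 has_real_derivative N3' t) (at t)"
    and G: "\<And>t. t \<in> {0..1} \<Longrightarrow> (G1 has_real_derivative G1' t) (at t)"
      "\<And>t. t \<in> {0..1} \<Longrightarrow> (G2 has_real_derivative G2' t) (at t)"
      "\<And>t. t \<in> {0..1} \<Longrightarrow> (G3 has_real_derivative G3' t) (at t)"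
    and pos: "\<And>t. t \<in> {0..1} \<Longrightarrow> G1 t > 0" "\<And>t. t \<in> {0..1} \<Longrightarrow> G2 t > 0" "\<And>t. t \<in> {0..1} \<Longrightarrow> G3 t > 0"
    and D: "\<And>t. t \<in> {0..1} \<Longrightarrow> G1 t - (N1 t)\<^sup>2 = D t" "\<And>t. t \<in> {0..1} \<Longrightarrow> G2 t - (N2 t)\<^sup>2 = D t"
      "\<And>t. t \<in> {0..1} \<Longrightarrow> G3 t - (N3 t)\<^sup>2 = D t" "D 0 > 0"
    and neg: "\<And>t. t \<in> {0..1} \<Longrightarrow> D t > 0 \<Longrightarrow>
       d1 * - (N1' t - N1 t * G1' t / (2 * G1 t)) + d2 * - (N2' t - N2 t * G2' t / (2 * G2 t))
       + d3 * - (N3' t - N3 t * G3' t / (2 * G3 t)) < 0"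
  shows "d1 * clamped_angle (N1 1) (G1 1) + d2 * clamped_angle (N2 1) (G2 1) + d3 * clamped_angle (N3 1) (G3 1)
       < d1 * clamped_angle (N1 0) (G1 0) + d2 * clamped_angle (N2 0) (G2 0) + d3 * clamped_angle (N3 0) (G3 0)"
proof -
  define \<phi> where "\<phi> t = d1 * clamped_angle (N1 t) (G1 t) + d2 * clamped_angle (N2 t) (G2 t)
    + d3 * clamped_angle (N3 t) (G3 t)" for t
  define S where "S = (\<lambda>(x,y,z). d1 * x + d2 * y + d3 * z) ` ({0,pi} \<times> {0,pi} \<times> {0,pi})"
  have "finite S" unfolding S_def by simp
  have cont_if: "continuous_on {0..1} f" if "\<And>t. t \<in> {0..1} \<Longrightarrow> (f has_real_derivative f' t) (at t)"
    for f f' :: "real \<Rightarrow> real"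
    using that by (intro DERIV_continuous_on) (rule has_field_derivative_at_within)
  have cont: "continuous_on {0..1} \<phi>" unfolding \<phi>_def
    by (intro continuous_on_add continuous_on_mult_left continuous_on_clamped_angle
        cont_if[OF N(1)] cont_if[OF N(2)] cont_if[OF N(3)] cont_if[OF G(1)] cont_if[OF G(2)] cont_if[OF G(3)] pos)
  have deriv: "\<exists>D'<0. (\<phi> has_real_derivative D') (at t)" if t: "t \<in> {0..1}" and "D t > 0" for t
  proof -
    have lt: "(N1 t)\<^sup>2 < G1 t" "(N2 t)\<^sup>2 < G2 t" "(N3 t)\<^sup>2 < G3 t" using D(1-3)[OF t] \<open>D t > 0\<close> by linarith+
    let ?X1 = "- (N1' t - N1 t * G1' t / (2 * G1 t))"
    let ?X2 = "- (N2' t - N2 t * G2' t / (2 * G2 t))"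
    let ?X3 = "- (N3' t - N3 t * G3' t / (2 * G3 t))"
    have "(\<phi> has_real_derivative d1 * (?X1 / sqrt (D t)) + d2 * (?X2 / sqrt (D t)) + d3 * (?X3 / sqrt (D t))) (at t)"
      unfolding \<phi>_def
      using DERIV_clamped_angle[OF N(1)[OF t] G(1)[OF t] pos(1)[OF t] lt(1)]
        DERIV_clamped_angle[OF N(2)[OF t] G(2)[OF t] pos(2)[OF t] lt(2)]
        DERIV_clamped_angle[OF N(3)[OF t] G(3)[OF t] pos(3)[OF t] lt(3)]
      unfolding D(1-3)[OF t] by (intro DERIV_add DERIV_cmult)
    moreover have "d1 * (?X1 / sqrt (D t)) + d2 * (?X2 / sqrt (D t)) + d3 * (?X3 / sqrt (D t))
      = (d1 * ?X1 + d2 * ?X2 + d3 * ?X3) / sqrt (D t)"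
      by (simp only: times_divide_eq_right add_divide_distrib)
    moreover have "\<dots> < 0" using neg[OF t \<open>D t > 0\<close>] \<open>D t > 0\<close> by (intro divide_neg_pos) auto
    ultimately show ?thesis by metis
  qed
  have admissible: "D t > 0" if "t \<in> {0..1}" "\<phi> t \<notin> S" for t
  proof (rule ccontr)
    assume "\<not> D t > 0"
    then have le: "G1 t \<le> (N1 t)\<^sup>2" "G2 t \<le> (N2 t)\<^sup>2" "G3 t \<le> (N3 t)\<^sup>2"
      using D(1-3)[OF that(1)] by linarith+
    have "(clamped_angle (N1 t) (G1 t), clamped_angle (N2 t) (G2 t), clamped_angle (N3 t) (G3 t))
        \<in> {0,pi} \<times> {0,pi} \<times> {0,pi}"
      by (intro SigmaI clamped_angle_degenerate pos le that(1))
    then have "\<phi> t \<in> S" unfolding S_def \<phi>_def by (rule rev_image_eqI) simp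
    with that show False by simp
  qed
  \<comment> \<open>Strictness comes from the start, where the triangle is nondegenerate;
    \<open>nonincreasing_off_finite\<close> gives only a weak inequality on the rest.\<close>
  obtain D' where "D' < 0" "(\<phi> has_real_derivative D') (at 0)" using deriv[of 0] D(4) by auto
  then obtain \<delta> where \<delta>: "\<delta> > 0" "\<And>h. 0 < h \<Longrightarrow> h < \<delta> \<Longrightarrow> \<phi> (0 + h) < \<phi> 0"
    using DERIV_neg_dec_right by blast
  define h where "h = min (\<delta>/2) 1"
  have h: "0 < h" "h < \<delta>" "h \<le> 1" using \<delta> unfolding h_def by auto
  have "\<phi> 1 \<le> \<phi> h"
  proof (rule nonincreasing_off_finite[OF _ \<open>finite S\<close> h(3)])
    show "continuous_on {h..1} \<phi>" using cont h by (auto intro: continuous_on_subset)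
  next
    fix t assume "h \<le> t" "t < 1" "\<phi> t \<notin> S"
    then show "\<exists>D<0. (\<phi> has_real_derivative D) (at t)" using h by (intro deriv admissible) auto
  qed
  also have "\<phi> h < \<phi> 0" using \<delta>(2)[of h] h by simp
  finally show ?thesis unfolding \<phi>_def .
qed

section \<open>Derivatives of sides and angles along a segment of conformal coordinates\<close>

lemma hyp_angle_derivative:
  fixes x y z X Y Z p q :: real
  assumes "p = x\<^sup>2 - 1" "q = y\<^sup>2 - 1" "p > 0" "q > 0"
  shows "- (X*y + Y*x - Z - (x*y - z) * (2*x*X*q + 2*y*Y*p) / (2 * (p*q))) = Z - (x*z - y)/p*X - (y*z - x)/q*Y"
proof -
  have "(x*y - z) * (2*x*X*q + 2*y*Y*p) / (2 * (p*q)) = (x*y - z)*x/p*X + (x*y - z)*y/q*Y"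
    using assms(3,4) by (simp add: field_simps)
  moreover have "y - (x*y - z)*x/p = (x*z - y)/p" "x - (x*y - z)*y/q = (y*z - x)/q"
    using assms(3,4) unfolding assms(1,2) by (simp_all add: field_simps power2_eq_square)
  then have "(x*z - y)/p*X = y*X - (x*y - z)*x/p*X" "(y*z - x)/q*Y = x*Y - (x*y - z)*y/q*Y"
    by (simp_all add: left_diff_distrib flip: \<open>y - (x*y - z)*x/p = (x*z - y)/p\<close> \<open>x - (x*y - z)*y/q = (y*z - x)/q\<close>)
  ultimately show ?thesis by (simp add: algebra_simps)
qed

lemma hyp_cosh_derivative:
  fixes r s h k :: "real \<Rightarrow> real"
  assumes "(r has_real_derivative r t * h t * d) (at t)" "(s has_real_derivative s t * k t * d') (at t)"
    "(h has_real_derivative e * (r t)\<^sup>2 * d) (at t)" "(k has_real_derivative e' * (s t)\<^sup>2 * d') (at t)"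
    and hr: "(h t)\<^sup>2 = 1 + e * (r t)\<^sup>2" and ks: "(k t)\<^sup>2 = 1 + e' * (s t)\<^sup>2"
    and C: "C = h t * k t + q * (r t * s t)"
  shows "((\<lambda>t. h t * k t + q * (r t * s t)) has_real_derivative (h t * C - k t) * d + (k t * C - h t) * d') (at t)"
proof -
  have 1: "h t * C - k t = e * (r t)\<^sup>2 * k t + q * (r t * h t * s t)" unfolding C using hr by algebra
  have 2: "k t * C - h t = e' * (s t)\<^sup>2 * h t + q * (r t * (s t * k t))" unfolding C using ks by algebra
  show ?thesis unfolding 1 2
    by (rule derivative_eq_intros assms refl)+ (simp add: algebra_simps)
qed

lemma euc_angle_derivative:
  fixes x y z X Y Z :: real
  assumes "x > 0" "y > 0"
  shows "- (X + Y - Z - (x + y - z) * (4 * (X*y + Y*x)) / (2 * (4*x*y))) =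
    Z - (x + z - y)/(2*x)*X - (y + z - x)/(2*y)*Y"
  using assms by (simp add: field_simps)

lemma euc_sq_length_derivative:
  fixes r s :: "real \<Rightarrow> real"
  assumes "(r has_real_derivative r t * d) (at t)" "(s has_real_derivative s t * d') (at t)"
    and L: "L = e * (r t)\<^sup>2 + e' * (s t)\<^sup>2 + 2 * q * (r t * s t)"
  shows "((\<lambda>t. e * (r t)\<^sup>2 + e' * (s t)\<^sup>2 + 2 * q * (r t * s t)) has_real_derivative
    (L + e * (r t)\<^sup>2 - e' * (s t)\<^sup>2) * d + (L + e' * (s t)\<^sup>2 - e * (r t)\<^sup>2) * d') (at t)"
  unfolding L
  by (rule derivative_eq_intros assms refl)+ (simp add: algebra_simps power2_eq_square)

context face_weights
begin

text \<open>The segment enters only through the differential equations for radius and height in the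
  conformal coordinate; nondegeneracy of the triangle is demanded at time 0.\<close>

lemma hyp_angle_sum_decreasing:
  fixes r1 r2 r3 h1 h2 h3 :: "real \<Rightarrow> real" and d1 d2 d3 :: real
  assumes r: "\<And>t. t \<in> {0..1} \<Longrightarrow> r1 t > 0" "\<And>t. t \<in> {0..1} \<Longrightarrow> r2 t > 0" "\<And>t. t \<in> {0..1} \<Longrightarrow> r3 t > 0"
    and h: "\<And>t. t \<in> {0..1} \<Longrightarrow> h1 t > 0" "\<And>t. t \<in> {0..1} \<Longrightarrow> h2 t > 0" "\<And>t. t \<in> {0..1} \<Longrightarrow> h3 t > 0"
    and hr: "\<And>t. t \<in> {0..1} \<Longrightarrow> (h1 t)\<^sup>2 = 1 + e1 * (r1 t)\<^sup>2" "\<And>t. t \<in> {0..1} \<Longrightarrow> (h2 t)\<^sup>2 = 1 + e2 * (r2 t)\<^sup>2"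
      "\<And>t. t \<in> {0..1} \<Longrightarrow> (h3 t)\<^sup>2 = 1 + e3 * (r3 t)\<^sup>2"
    and r': "\<And>t. t \<in> {0..1} \<Longrightarrow> (r1 has_real_derivative r1 t * h1 t * d1) (at t)"
      "\<And>t. t \<in> {0..1} \<Longrightarrow> (r2 has_real_derivative r2 t * h2 t * d2) (at t)"
      "\<And>t. t \<in> {0..1} \<Longrightarrow> (r3 has_real_derivative r3 t * h3 t * d3) (at t)"
    and h': "\<And>t. t \<in> {0..1} \<Longrightarrow> (h1 has_real_derivative e1 * (r1 t)\<^sup>2 * d1) (at t)"
      "\<And>t. t \<in> {0..1} \<Longrightarrow> (h2 has_real_derivative e2 * (r2 t)\<^sup>2 * d2) (at t)"
      "\<And>t. t \<in> {0..1} \<Longrightarrow> (h3 has_real_derivative e3 * (r3 t)\<^sup>2 * d3) (at t)"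
  defines "c1 \<equiv> \<lambda>t. h2 t * h3 t + a * (r2 t * r3 t)"
    and "c2 \<equiv> \<lambda>t. h1 t * h3 t + b * (r1 t * r3 t)"
    and "c3 \<equiv> \<lambda>t. h1 t * h2 t + c * (r1 t * r2 t)"
  assumes D0: "1 + 2 * c1 0 * c2 0 * c3 0 - (c1 0)\<^sup>2 - (c2 0)\<^sup>2 - (c3 0)\<^sup>2 > 0"
    and d: "\<not> (d1 = 0 \<and> d2 = 0 \<and> d3 = 0)"
  defines "\<theta>1 \<equiv> \<lambda>t. clamped_angle (c2 t * c3 t - c1 t) (((c2 t)\<^sup>2 - 1) * ((c3 t)\<^sup>2 - 1))"
    and "\<theta>2 \<equiv> \<lambda>t. clamped_angle (c3 t * c1 t - c2 t) (((c3 t)\<^sup>2 - 1) * ((c1 t)\<^sup>2 - 1))"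
    and "\<theta>3 \<equiv> \<lambda>t. clamped_angle (c1 t * c2 t - c3 t) (((c1 t)\<^sup>2 - 1) * ((c2 t)\<^sup>2 - 1))"
  shows "d1 * \<theta>1 1 + d2 * \<theta>2 1 + d3 * \<theta>3 1 < d1 * \<theta>1 0 + d2 * \<theta>2 0 + d3 * \<theta>3 0"
proof -
  define D where "D t = 1 + 2 * c1 t * c2 t * c3 t - (c1 t)\<^sup>2 - (c2 t)\<^sup>2 - (c3 t)\<^sup>2" for t
  define E1 where "E1 t = (h2 t * c1 t - h3 t) * d2 + (h3 t * c1 t - h2 t) * d3" for t
  define E2 where "E2 t = (h3 t * c2 t - h1 t) * d3 + (h1 t * c2 t - h3 t) * d1" for t
  define E3 where "E3 t = (h1 t * c3 t - h2 t) * d1 + (h2 t * c3 t - h1 t) * d2" for t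
  have c_gt: "c1 t > 1" "c2 t > 1" "c3 t > 1" if t: "t \<in> {0..1}" for t
    unfolding c1_def c2_def c3_def
    by (rule cosh_edge_gt_1[OF eps(2,3) edge(1) r(2,3)[OF t] h(2,3)[OF t] hr(2,3)[OF t]]
      cosh_edge_gt_1[OF eps(1,3) edge(2) r(1,3)[OF t] h(1,3)[OF t] hr(1,3)[OF t]]
      cosh_edge_gt_1[OF eps(1,2) edge(3) r(1,2)[OF t] h(1,2)[OF t] hr(1,2)[OF t]])+
  then have s_pos: "(c1 t)\<^sup>2 - 1 > 0" "(c2 t)\<^sup>2 - 1 > 0" "(c3 t)\<^sup>2 - 1 > 0" if "t \<in> {0..1}" for t
    using that by (simp_all add: power2_gt_1_iff)
  have face: "hyp_face e1 e2 e3 a b c (r1 t) (r2 t) (r3 t) (h1 t) (h2 t) (h3 t) (c1 t) (c2 t) (c3 t) (D t)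
     ((c1 t)\<^sup>2 - 1) ((c2 t)\<^sup>2 - 1) ((c3 t)\<^sup>2 - 1)
     ((h1 t * (1 - (c1 t)\<^sup>2) + h2 t * (c1 t*c2 t - c3 t) + h3 t * (c1 t*c3 t - c2 t)) / ((c1 t)\<^sup>2 - 1))
     ((h2 t * (1 - (c2 t)\<^sup>2) + h3 t * (c2 t*c3 t - c1 t) + h1 t * (c2 t*c1 t - c3 t)) / ((c2 t)\<^sup>2 - 1))
     ((h3 t * (1 - (c3 t)\<^sup>2) + h1 t * (c3 t*c1 t - c2 t) + h2 t * (c3 t*c2 t - c1 t)) / ((c3 t)\<^sup>2 - 1))"
    if t: "t \<in> {0..1}" and D: "D t > 0" for t
  proof -
    have c: "c1 t = h2 t * h3 t + a * (r2 t * r3 t)" "c2 t = h1 t * h3 t + b * (r1 t * r3 t)"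
      "c3 t = h1 t * h2 t + c * (r1 t * r2 t)"
      by (simp_all add: c1_def c2_def c3_def)
    have q: "x / ((c1 t)\<^sup>2 - 1) * ((c1 t)\<^sup>2 - 1) = x" "x / ((c2 t)\<^sup>2 - 1) * ((c2 t)\<^sup>2 - 1) = x"
      "x / ((c3 t)\<^sup>2 - 1) * ((c3 t)\<^sup>2 - 1) = x" for x
      using s_pos[OF t] by simp_all
    show ?thesis
      by unfold_locales (fact r[OF t] h[OF t] hr[OF t] c D_def D refl q)+
  qed
  have dc1: "(c1 has_real_derivative E1 t) (at t)" if t: "t \<in> {0..1}" for t
    unfolding E1_def using hyp_cosh_derivative[OF r'(2,3)[OF t] h'(2,3)[OF t] hr(2,3)[OF t], of "c1 t" a]
    by (simp add: c1_def)
  have dc2: "(c2 has_real_derivative E2 t) (at t)" if t: "t \<in> {0..1}" for t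
    unfolding E2_def using hyp_cosh_derivative[OF r'(1,3)[OF t] h'(1,3)[OF t] hr(1,3)[OF t], of "c2 t" b]
    by (simp add: c2_def add_ac)
  have dc3: "(c3 has_real_derivative E3 t) (at t)" if t: "t \<in> {0..1}" for t
    unfolding E3_def using hyp_cosh_derivative[OF r'(1,2)[OF t] h'(1,2)[OF t] hr(1,2)[OF t], of "c3 t" c]
    by (simp add: c3_def)
  note dc = dc1 dc2 dc3
  show ?thesis unfolding \<theta>1_def \<theta>2_def \<theta>3_def
  proof (rule angle_sum_decreasing[where D = D
      and ?N1' = "\<lambda>t. E2 t * c3 t + E3 t * c2 t - E1 t"
      and ?N2' = "\<lambda>t. E3 t * c1 t + E1 t * c3 t - E2 t"
      and ?N3' = "\<lambda>t. E1 t * c2 t + E2 t * c1 t - E3 t"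
      and ?G1' = "\<lambda>t. 2 * c2 t * E2 t * ((c3 t)\<^sup>2 - 1) + 2 * c3 t * E3 t * ((c2 t)\<^sup>2 - 1)"
      and ?G2' = "\<lambda>t. 2 * c3 t * E3 t * ((c1 t)\<^sup>2 - 1) + 2 * c1 t * E1 t * ((c3 t)\<^sup>2 - 1)"
      and ?G3' = "\<lambda>t. 2 * c1 t * E1 t * ((c2 t)\<^sup>2 - 1) + 2 * c2 t * E2 t * ((c1 t)\<^sup>2 - 1)"])
    show "D 0 > 0" using D0 by (simp add: D_def)
  next
    fix t :: real assume t: "t \<in> {0..1}" and "D t > 0"
    show "d1 * - (E2 t * c3 t + E3 t * c2 t - E1 t - (c2 t * c3 t - c1 t) * (2 * c2 t * E2 t * ((c3 t)\<^sup>2 - 1) + 2 * c3 t * E3 t * ((c2 t)\<^sup>2 - 1)) / (2 * (((c2 t)\<^sup>2 - 1) * ((c3 t)\<^sup>2 - 1))))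
      + d2 * - (E3 t * c1 t + E1 t * c3 t - E2 t - (c3 t * c1 t - c2 t) * (2 * c3 t * E3 t * ((c1 t)\<^sup>2 - 1) + 2 * c1 t * E1 t * ((c3 t)\<^sup>2 - 1)) / (2 * (((c3 t)\<^sup>2 - 1) * ((c1 t)\<^sup>2 - 1))))
      + d3 * - (E1 t * c2 t + E2 t * c1 t - E3 t - (c1 t * c2 t - c3 t) * (2 * c1 t * E1 t * ((c2 t)\<^sup>2 - 1) + 2 * c2 t * E2 t * ((c1 t)\<^sup>2 - 1)) / (2 * (((c1 t)\<^sup>2 - 1) * ((c2 t)\<^sup>2 - 1)))) < 0"
      unfolding hyp_angle_derivative[OF refl refl s_pos(2,3)[OF t]]
        hyp_angle_derivative[OF refl refl s_pos(3,1)[OF t]] hyp_angle_derivative[OF refl refl s_pos(1,2)[OF t]]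
      using hyp_face.angle_form_neg[OF face[OF t \<open>D t > 0\<close>] d]
      unfolding E1_def E2_def E3_def .
  next
    fix t :: real assume t: "t \<in> {0..1}"
    show "((c2 t)\<^sup>2 - 1) * ((c3 t)\<^sup>2 - 1) > 0" "((c3 t)\<^sup>2 - 1) * ((c1 t)\<^sup>2 - 1) > 0"
      "((c1 t)\<^sup>2 - 1) * ((c2 t)\<^sup>2 - 1) > 0"
      using s_pos[OF t] by simp_all
    show "((c2 t)\<^sup>2 - 1) * ((c3 t)\<^sup>2 - 1) - (c2 t * c3 t - c1 t)\<^sup>2 = D t"
      "((c3 t)\<^sup>2 - 1) * ((c1 t)\<^sup>2 - 1) - (c3 t * c1 t - c2 t)\<^sup>2 = D t"
      "((c1 t)\<^sup>2 - 1) * ((c2 t)\<^sup>2 - 1) - (c1 t * c2 t - c3 t)\<^sup>2 = D t"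
      unfolding D_def by algebra+
    show "((\<lambda>t. c2 t * c3 t - c1 t) has_real_derivative E2 t * c3 t + E3 t * c2 t - E1 t) (at t)"
      "((\<lambda>t. c3 t * c1 t - c2 t) has_real_derivative E3 t * c1 t + E1 t * c3 t - E2 t) (at t)"
      "((\<lambda>t. c1 t * c2 t - c3 t) has_real_derivative E1 t * c2 t + E2 t * c1 t - E3 t) (at t)"
      by (intro DERIV_diff DERIV_mult dc t)+
    have sq: "((\<lambda>t. ((x t)\<^sup>2 - 1) * ((y t)\<^sup>2 - 1)) has_real_derivative
        2 * x t * x' * ((y t)\<^sup>2 - 1) + 2 * y t * y' * ((x t)\<^sup>2 - 1)) (at t)"
      if "(x has_real_derivative x') (at t)" "(y has_real_derivative y') (at t)" for x y :: "real \<Rightarrow> real" and x' y'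
      by (auto intro!: derivative_eq_intros that)
    show "((\<lambda>t. ((c2 t)\<^sup>2 - 1) * ((c3 t)\<^sup>2 - 1)) has_real_derivative
        2 * c2 t * E2 t * ((c3 t)\<^sup>2 - 1) + 2 * c3 t * E3 t * ((c2 t)\<^sup>2 - 1)) (at t)"
      "((\<lambda>t. ((c3 t)\<^sup>2 - 1) * ((c1 t)\<^sup>2 - 1)) has_real_derivative
        2 * c3 t * E3 t * ((c1 t)\<^sup>2 - 1) + 2 * c1 t * E1 t * ((c3 t)\<^sup>2 - 1)) (at t)"
      "((\<lambda>t. ((c1 t)\<^sup>2 - 1) * ((c2 t)\<^sup>2 - 1)) has_real_derivative
        2 * c1 t * E1 t * ((c2 t)\<^sup>2 - 1) + 2 * c2 t * E2 t * ((c1 t)\<^sup>2 - 1)) (at t)"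
      by (intro sq dc t)+
  qed
qed

lemma euc_angle_sum_decreasing:
  fixes r1 r2 r3 :: "real \<Rightarrow> real" and d1 d2 d3 :: real
  assumes r: "\<And>t. t \<in> {0..1} \<Longrightarrow> r1 t > 0" "\<And>t. t \<in> {0..1} \<Longrightarrow> r2 t > 0" "\<And>t. t \<in> {0..1} \<Longrightarrow> r3 t > 0"
    and r': "\<And>t. t \<in> {0..1} \<Longrightarrow> (r1 has_real_derivative r1 t * d1) (at t)"
      "\<And>t. t \<in> {0..1} \<Longrightarrow> (r2 has_real_derivative r2 t * d2) (at t)"
      "\<And>t. t \<in> {0..1} \<Longrightarrow> (r3 has_real_derivative r3 t * d3) (at t)"
  defines "L1 \<equiv> \<lambda>t. e2 * (r2 t)\<^sup>2 + e3 * (r3 t)\<^sup>2 + 2 * a * (r2 t * r3 t)"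
    and "L2 \<equiv> \<lambda>t. e1 * (r1 t)\<^sup>2 + e3 * (r3 t)\<^sup>2 + 2 * b * (r1 t * r3 t)"
    and "L3 \<equiv> \<lambda>t. e1 * (r1 t)\<^sup>2 + e2 * (r2 t)\<^sup>2 + 2 * c * (r1 t * r2 t)"
  assumes D0: "2 * (L1 0 * L2 0 + L2 0 * L3 0 + L3 0 * L1 0) - (L1 0)\<^sup>2 - (L2 0)\<^sup>2 - (L3 0)\<^sup>2 > 0"
    and d: "\<not> (d1 = d2 \<and> d2 = d3)"
  defines "\<theta>1 \<equiv> \<lambda>t. clamped_angle (L2 t + L3 t - L1 t) (4 * L2 t * L3 t)"
    and "\<theta>2 \<equiv> \<lambda>t. clamped_angle (L3 t + L1 t - L2 t) (4 * L3 t * L1 t)"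
    and "\<theta>3 \<equiv> \<lambda>t. clamped_angle (L1 t + L2 t - L3 t) (4 * L1 t * L2 t)"
  shows "d1 * \<theta>1 1 + d2 * \<theta>2 1 + d3 * \<theta>3 1 < d1 * \<theta>1 0 + d2 * \<theta>2 0 + d3 * \<theta>3 0"
proof -
  define D where "D t = 2 * (L1 t * L2 t + L2 t * L3 t + L3 t * L1 t) - (L1 t)\<^sup>2 - (L2 t)\<^sup>2 - (L3 t)\<^sup>2" for t
  define s1 s2 s3 where "s1 t = e1 * (r1 t)\<^sup>2" and "s2 t = e2 * (r2 t)\<^sup>2" and "s3 t = e3 * (r3 t)\<^sup>2" for t
  define E1 where "E1 t = (L1 t + s2 t - s3 t) * d2 + (L1 t + s3 t - s2 t) * d3" for t
  define E2 where "E2 t = (L2 t + s3 t - s1 t) * d3 + (L2 t + s1 t - s3 t) * d1" for t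
  define E3 where "E3 t = (L3 t + s1 t - s2 t) * d1 + (L3 t + s2 t - s1 t) * d2" for t
  have L_pos: "L1 t > 0" "L2 t > 0" "L3 t > 0" if t: "t \<in> {0..1}" for t
    unfolding L1_def L2_def L3_def
    by (rule euc_edge_pos[OF eps(2,3) edge(1) r(2,3)[OF t]] euc_edge_pos[OF eps(1,3) edge(2) r(1,3)[OF t]]
      euc_edge_pos[OF eps(1,2) edge(3) r(1,2)[OF t]])+
  have face: "euc_face e1 e2 e3 a b c (r1 t) (r2 t) (r3 t) (D t)
     ((L1 t * (L2 t + L3 t - L1 t) - 2 * L1 t * s1 t + s2 t * (L1 t + L2 t - L3 t) + s3 t * (L1 t + L3 t - L2 t)) / L1 t)
     ((L2 t * (L3 t + L1 t - L2 t) - 2 * L2 t * s2 t + s3 t * (L2 t + L3 t - L1 t) + s1 t * (L2 t + L1 t - L3 t)) / L2 t)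
     ((L3 t * (L1 t + L2 t - L3 t) - 2 * L3 t * s3 t + s1 t * (L3 t + L1 t - L2 t) + s2 t * (L3 t + L2 t - L1 t)) / L3 t)
     (L1 t) (L2 t) (L3 t) (s1 t) (s2 t) (s3 t)"
    if t: "t \<in> {0..1}" and D: "D t > 0" for t
  proof -
    have L0: "L1 t \<noteq> 0" "L2 t \<noteq> 0" "L3 t \<noteq> 0" using L_pos[OF t] by auto
    have L: "L1 t = e2 * (r2 t)\<^sup>2 + e3 * (r3 t)\<^sup>2 + 2 * a * (r2 t * r3 t)"
      "L2 t = e1 * (r1 t)\<^sup>2 + e3 * (r3 t)\<^sup>2 + 2 * b * (r1 t * r3 t)"
      "L3 t = e1 * (r1 t)\<^sup>2 + e2 * (r2 t)\<^sup>2 + 2 * c * (r1 t * r2 t)"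
      by (simp_all add: L1_def L2_def L3_def)
    have q: "x / L1 t * L1 t = x" "x / L2 t * L2 t = x" "x / L3 t * L3 t = x" for x
      using L0 by simp_all
    show ?thesis
      by unfold_locales (fact r[OF t] L D_def D s1_def s2_def s3_def q)+
  qed
  have dL1: "(L1 has_real_derivative E1 t) (at t)" if t: "t \<in> {0..1}" for t
    unfolding E1_def s2_def s3_def using euc_sq_length_derivative[OF r'(2,3)[OF t], of "L1 t" e2 e3 a]
    by (simp add: L1_def)
  have dL2: "(L2 has_real_derivative E2 t) (at t)" if t: "t \<in> {0..1}" for t
    unfolding E2_def s1_def s3_def using euc_sq_length_derivative[OF r'(1,3)[OF t], of "L2 t" e1 e3 b]
    by (simp add: L2_def add_ac)
  have dL3: "(L3 has_real_derivative E3 t) (at t)" if t: "t \<in> {0..1}" for t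
    unfolding E3_def s1_def s2_def using euc_sq_length_derivative[OF r'(1,2)[OF t], of "L3 t" e1 e2 c]
    by (simp add: L3_def)
  note dL = dL1 dL2 dL3
  show ?thesis unfolding \<theta>1_def \<theta>2_def \<theta>3_def
  proof (rule angle_sum_decreasing[where D = D
      and ?N1' = "\<lambda>t. E2 t + E3 t - E1 t" and ?N2' = "\<lambda>t. E3 t + E1 t - E2 t" and ?N3' = "\<lambda>t. E1 t + E2 t - E3 t"
      and ?G1' = "\<lambda>t. 4 * (E2 t * L3 t + E3 t * L2 t)" and ?G2' = "\<lambda>t. 4 * (E3 t * L1 t + E1 t * L3 t)"
      and ?G3' = "\<lambda>t. 4 * (E1 t * L2 t + E2 t * L1 t)"])
    show "D 0 > 0" using D0 by (simp add: D_def)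
  next
    fix t :: real assume t: "t \<in> {0..1}" and "D t > 0"
    show "d1 * - (E2 t + E3 t - E1 t - (L2 t + L3 t - L1 t) * (4 * (E2 t * L3 t + E3 t * L2 t)) / (2 * (4 * L2 t * L3 t)))
      + d2 * - (E3 t + E1 t - E2 t - (L3 t + L1 t - L2 t) * (4 * (E3 t * L1 t + E1 t * L3 t)) / (2 * (4 * L3 t * L1 t)))
      + d3 * - (E1 t + E2 t - E3 t - (L1 t + L2 t - L3 t) * (4 * (E1 t * L2 t + E2 t * L1 t)) / (2 * (4 * L1 t * L2 t))) < 0"
      unfolding euc_angle_derivative[OF L_pos(2,3)[OF t]]
        euc_angle_derivative[OF L_pos(3,1)[OF t]] euc_angle_derivative[OF L_pos(1,2)[OF t]]
      using euc_face.angle_form_neg[OF face[OF t \<open>D t > 0\<close>] d]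
      unfolding E1_def E2_def E3_def .
  next
    fix t :: real assume t: "t \<in> {0..1}"
    show "4 * L2 t * L3 t > 0" "4 * L3 t * L1 t > 0" "4 * L1 t * L2 t > 0"
      using L_pos[OF t] by simp_all
    show "4 * L2 t * L3 t - (L2 t + L3 t - L1 t)\<^sup>2 = D t" "4 * L3 t * L1 t - (L3 t + L1 t - L2 t)\<^sup>2 = D t"
      "4 * L1 t * L2 t - (L1 t + L2 t - L3 t)\<^sup>2 = D t"
      unfolding D_def by algebra+
    show "((\<lambda>t. 4 * L2 t * L3 t) has_real_derivative 4 * (E2 t * L3 t + E3 t * L2 t)) (at t)"
      "((\<lambda>t. 4 * L3 t * L1 t) has_real_derivative 4 * (E3 t * L1 t + E1 t * L3 t)) (at t)"
      "((\<lambda>t. 4 * L1 t * L2 t) has_real_derivative 4 * (E1 t * L2 t + E2 t * L1 t)) (at t)"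
      by (auto intro!: derivative_eq_intros dL t simp: algebra_simps)
    show "((\<lambda>t. L2 t + L3 t - L1 t) has_real_derivative E2 t + E3 t - E1 t) (at t)"
      "((\<lambda>t. L3 t + L1 t - L2 t) has_real_derivative E3 t + E1 t - E2 t) (at t)"
      "((\<lambda>t. L1 t + L2 t - L3 t) has_real_derivative E1 t + E2 t - E3 t) (at t)"
      by (intro DERIV_add DERIV_diff dL t)+
  qed
qed

end

section \<open>Angles of triangles\<close>

lemma euc_triangle_discriminant:
  fixes a b c :: real
  assumes "a > 0" "b > 0" "c > 0" "c < a + b" "a < b + c" "b < a + c"
  shows "(a\<^sup>2 + b\<^sup>2 - c\<^sup>2)\<^sup>2 < 4 * a\<^sup>2 * b\<^sup>2"
proof -
  have "\<bar>a - b\<bar> < c" using assms by linarith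
  then have "(a - b)\<^sup>2 < c\<^sup>2" using power_strict_mono[of "\<bar>a - b\<bar>" c 2] by simp
  moreover have "c\<^sup>2 < (a + b)\<^sup>2" using assms by (intro power_strict_mono) auto
  ultimately have "\<bar>a\<^sup>2 + b\<^sup>2 - c\<^sup>2\<bar> < 2 * a * b"
    by (simp add: abs_less_iff power2_eq_square algebra_simps)
  then have "(a\<^sup>2 + b\<^sup>2 - c\<^sup>2)\<^sup>2 < (2 * a * b)\<^sup>2"
    using power_strict_mono[of "\<bar>a\<^sup>2 + b\<^sup>2 - c\<^sup>2\<bar>" "2 * a * b" 2] by simp
  then show ?thesis by (simp add: power_mult_distrib)
qed

text \<open>\<open>inner_angle\<close> is a definite description, so both directions matter: the law
  of cosines fixes the angle in every placement, and an explicit placement shows that the angle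
  occurs.\<close>

lemma triangle_angle_Euclidean_iff:
  assumes "a > 0" "b > 0" "c > 0" "c < a + b" "a < b + c" "b < a + c"
  shows "triangle_angle Euclidean a b c \<theta> \<longleftrightarrow> \<theta> = clamped_angle (a\<^sup>2 + b\<^sup>2 - c\<^sup>2) (4 * a\<^sup>2 * b\<^sup>2)"
proof -
  let ?N = "a\<^sup>2 + b\<^sup>2 - c\<^sup>2"
  have sq: "sqrt (4 * a\<^sup>2 * b\<^sup>2) = 2 * a * b" using assms by (simp add: real_sqrt_mult)
  have lt: "\<bar>?N / sqrt (4 * a\<^sup>2 * b\<^sup>2)\<bar> < 1"
    using euc_triangle_discriminant[OF assms] assms by (intro abs_quotient_less_1) auto
  have angle: "clamped_angle ?N (4 * a\<^sup>2 * b\<^sup>2) = arccos (?N / (2 * a * b))"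
    using clamped_angle_eq[of ?N "4 * a\<^sup>2 * b\<^sup>2"] lt unfolding sq by simp
  have euc: "euc_angle p q r = clamped_angle ?N (4 * a\<^sup>2 * b\<^sup>2)"
    if "dist p q = a" "dist p r = b" "dist q r = c" for p q r
  proof -
    have n: "norm (q - p) = a" "norm (r - p) = b" "norm (q - r) = c"
      using that by (simp_all add: dist_norm norm_minus_commute)
    have "(norm (q - r))\<^sup>2 = (norm ((q - p) - (r - p)))\<^sup>2" by simp
    also have "\<dots> = (norm (q - p))\<^sup>2 + (norm (r - p))\<^sup>2 - 2 * ((q - p) \<bullet> (r - p))"
      unfolding power2_norm_eq_inner by (simp add: inner_diff inner_commute algebra_simps)
    finally have ip: "(q - p) \<bullet> (r - p) = ?N / 2" unfolding n by simp
    show ?thesis unfolding euc_angle_def angle n ip by (simp add: mult.assoc)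
  qed
  define \<gamma> where "\<gamma> = arccos (?N / (2 * a * b))"
  have cos: "cos \<gamma> = ?N / (2 * a * b)" unfolding \<gamma>_def using lt unfolding sq by (intro cos_arccos) linarith+
  \<comment> \<open>Standard placement: the vertex at the origin, one side on the first axis, the
    other at the angle given by the law of cosines.\<close>
  define q r :: "real^2" where "q = vector [a, 0]" and "r = vector [b * cos \<gamma>, b * sin \<gamma>]"
  have q: "dist 0 q = a" using assms
    by (simp add: norm_eq_sqrt_inner inner_vec_def sum_2 q_def)
  have r: "dist 0 r = b"
  proof -
    have "b * cos \<gamma> * (b * cos \<gamma>) + b * sin \<gamma> * (b * sin \<gamma>) = b\<^sup>2 * ((sin \<gamma>)\<^sup>2 + (cos \<gamma>)\<^sup>2)"
      by algebra
    then show ?thesis using assms by (simp add: norm_eq_sqrt_inner inner_vec_def sum_2 r_def)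
  qed
  have qr: "dist q r = c"
  proof -
    have "(a - b * cos \<gamma>) * (a - b * cos \<gamma>) + (0 - b * sin \<gamma>) * (0 - b * sin \<gamma>)
      = a\<^sup>2 + b\<^sup>2 * ((sin \<gamma>)\<^sup>2 + (cos \<gamma>)\<^sup>2) - 2 * a * b * cos \<gamma>"
      by algebra
    also have "\<dots> = a\<^sup>2 + b\<^sup>2 - 2 * a * b * cos \<gamma>" by simp
    also have "\<dots> = c\<^sup>2" unfolding cos using assms by simp
    finally show ?thesis using assms by (simp add: dist_norm norm_eq_sqrt_inner inner_vec_def sum_2 q_def r_def)
  qed
  show ?thesis
  proof
    assume "triangle_angle Euclidean a b c \<theta>"
    then show "\<theta> = clamped_angle ?N (4 * a\<^sup>2 * b\<^sup>2)" using euc by auto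
  next
    assume "\<theta> = clamped_angle ?N (4 * a\<^sup>2 * b\<^sup>2)"
    then have "\<theta> = euc_angle 0 q r" using euc[OF q r qr] by simp
    then show "triangle_angle Euclidean a b c \<theta>" unfolding triangle_angle.simps
      using q r qr by (intro exI[of _ 0] exI[of _ q] exI[of _ r] conjI)
  qed
qed

lemma hyp_triangle_discriminant:
  fixes a b c :: real
  assumes "a > 0" "b > 0" "c > 0" "c < a + b" "a < b + c" "b < a + c"
  shows "(cosh a * cosh b - cosh c)\<^sup>2 < ((cosh a)\<^sup>2 - 1) * ((cosh b)\<^sup>2 - 1)"
proof -
  have "cosh (a - b) < cosh c"
  proof -
    have "cosh (a - b) = cosh \<bar>a - b\<bar>" by (simp add: abs_if flip: cosh_minus[of "a - b"])
    also have "\<dots> < cosh c" using assms by (subst cosh_real_nonneg_less_iff) auto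
    finally show ?thesis .
  qed
  moreover have "cosh c < cosh (a + b)" using assms by (subst cosh_real_nonneg_less_iff) auto
  ultimately have "\<bar>cosh a * cosh b - cosh c\<bar> < sinh a * sinh b"
    by (simp add: cosh_add cosh_diff)
  then have "(cosh a * cosh b - cosh c)\<^sup>2 < (sinh a * sinh b)\<^sup>2"
    using power_strict_mono[of "\<bar>cosh a * cosh b - cosh c\<bar>" "sinh a * sinh b" 2] by simp
  then show ?thesis by (simp add: power_mult_distrib sinh_square_eq)
qed

text \<open>Reversed Cauchy-Schwarz inequality: the difference of the squares is itself a sum of
  three squares. It puts \<open>- mink p q\<close> in the range where \<open>cosh\<close> undoes
  \<open>arcosh\<close>.\<close>

lemma hyp_plane_mink_le:
  assumes "p \<in> hyp_plane" "q \<in> hyp_plane"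
  shows "- mink p q \<ge> 1"
proof -
  have p: "(p$3)\<^sup>2 = 1 + (p$1)\<^sup>2 + (p$2)\<^sup>2" "p$3 > 0" and q: "(q$3)\<^sup>2 = 1 + (q$1)\<^sup>2 + (q$2)\<^sup>2" "q$3 > 0"
    using assms by (auto simp: hyp_plane_def mink_def power2_eq_square)
  have "1 + (p$1 * q$1 + p$2 * q$2) \<le> p$3 * q$3"
  proof (rule power2_le_imp_le)
    have "(p$3 * q$3)\<^sup>2 - (1 + (p$1 * q$1 + p$2 * q$2))\<^sup>2
        = (p$1 - q$1)\<^sup>2 + (p$2 - q$2)\<^sup>2 + (p$1 * q$2 - p$2 * q$1)\<^sup>2"
      unfolding power_mult_distrib p q by algebra
    then show "(1 + (p$1 * q$1 + p$2 * q$2))\<^sup>2 \<le> (p$3 * q$3)\<^sup>2"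
      by (smt (verit) zero_le_power2)
  qed (use p q in simp)
  then show ?thesis by (simp add: mink_def)
qed

lemma mink_hyp_dir:
  assumes "p \<in> hyp_plane"
  shows "mink (hyp_dir p q) (hyp_dir p r) = mink q r + mink p q * mink p r"
proof -
  have "mink p p = - 1" using assms by (simp add: hyp_plane_def)
  then show ?thesis unfolding hyp_dir_def mink_def by simp algebra
qed

lemma triangle_angle_Hyperbolic_iff:
  assumes "a > 0" "b > 0" "c > 0" "c < a + b" "a < b + c" "b < a + c"
  shows "triangle_angle Hyperbolic a b c \<theta> \<longleftrightarrow>
    \<theta> = clamped_angle (cosh a * cosh b - cosh c) (((cosh a)\<^sup>2 - 1) * ((cosh b)\<^sup>2 - 1))"
proof -
  let ?N = "cosh a * cosh b - cosh c" and ?G = "((cosh a)\<^sup>2 - 1) * ((cosh b)\<^sup>2 - 1)"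
  have sq: "sqrt ?G = sinh a * sinh b" using assms
    by (simp add: real_sqrt_mult flip: sinh_square_eq)
  have "sinh a > 0" "sinh b > 0" using assms by simp_all
  then have "?G > 0" by (simp flip: sinh_square_eq)
  then have lt: "\<bar>?N / sqrt ?G\<bar> < 1"
    using hyp_triangle_discriminant[OF assms] by (intro abs_quotient_less_1)
  have angle: "clamped_angle ?N ?G = arccos (?N / sqrt ?G)"
    using clamped_angle_eq[of ?N ?G] lt by simp
  have hyp: "hyp_angle p q r = clamped_angle ?N ?G"
    if H: "p \<in> hyp_plane" "q \<in> hyp_plane" "r \<in> hyp_plane"
      and d: "hyp_dist p q = a" "hyp_dist p r = b" "hyp_dist q r = c" for p q r
  proof -
    have m: "mink p q = - cosh a" "mink p r = - cosh b" "mink q r = - cosh c"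
      using hyp_plane_mink_le[OF H(1,2)] hyp_plane_mink_le[OF H(1,3)] hyp_plane_mink_le[OF H(2,3)]
      by (simp_all add: hyp_dist_def cosh_arcosh_real flip: d)
    have "mink q q = - 1" "mink r r = - 1" using H by (auto simp: hyp_plane_def)
    then show ?thesis unfolding angle hyp_angle_def mink_hyp_dir[OF H(1)] m
      by (simp add: real_sqrt_mult power2_eq_square)
  qed
  define \<gamma> where "\<gamma> = arccos (?N / sqrt ?G)"
  have cos: "cos \<gamma> = ?N / (sinh a * sinh b)" unfolding \<gamma>_def sq[symmetric]
    using lt by (intro cos_arccos) linarith+
  \<comment> \<open>Geodesic polar coordinates around the lowest point of the hyperboloid: distance
    \<open>a\<close> in direction 0 and distance \<open>b\<close> in direction \<gamma>.\<close>
  define p q r :: "real^3" where "p = vector [0, 0, 1]" and "q = vector [sinh a, 0, cosh a]"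
    and "r = vector [sinh b * cos \<gamma>, sinh b * sin \<gamma>, cosh b]"
  have r2: "sinh b * cos \<gamma> * (sinh b * cos \<gamma>) + sinh b * sin \<gamma> * (sinh b * sin \<gamma>) = (sinh b)\<^sup>2"
  proof -
    have "sinh b * cos \<gamma> * (sinh b * cos \<gamma>) + sinh b * sin \<gamma> * (sinh b * sin \<gamma>)
      = (sinh b)\<^sup>2 * ((sin \<gamma>)\<^sup>2 + (cos \<gamma>)\<^sup>2)" by algebra
    then show ?thesis by simp
  qed
  have pq: "p \<in> hyp_plane" "q \<in> hyp_plane"
    by (simp_all add: hyp_plane_def mink_def p_def q_def sinh_square_eq cosh_real_pos flip: power2_eq_square)
  have r: "r \<in> hyp_plane"
  proof -
    have "mink r r = (sinh b)\<^sup>2 - (cosh b)\<^sup>2"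
      unfolding r2[symmetric] by (simp add: mink_def r_def power2_eq_square)
    then show ?thesis by (simp add: hyp_plane_def r_def sinh_square_eq)
  qed
  have d: "hyp_dist p q = a" "hyp_dist p r = b"
    using assms by (simp_all add: hyp_dist_def mink_def p_def q_def r_def arcosh_cosh_real)
  have qr: "hyp_dist q r = c"
  proof -
    have "cosh a * cosh b - sinh a * (sinh b * cos \<gamma>) = cosh c"
      unfolding cos using \<open>sinh a > 0\<close> \<open>sinh b > 0\<close> by simp
    then show ?thesis using assms
      by (simp add: hyp_dist_def mink_def q_def r_def arcosh_cosh_real)
  qed
  show ?thesis
  proof
    assume "triangle_angle Hyperbolic a b c \<theta>"
    then show "\<theta> = clamped_angle ?N ?G" using hyp by auto
  next
    assume "\<theta> = clamped_angle ?N ?G"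
    then have "\<theta> = hyp_angle p q r" using hyp[OF pq r d qr] by simp
    then show "triangle_angle Hyperbolic a b c \<theta>" using pq r d qr by auto
  qed
qed

text \<open>The description in \<open>inner_angle\<close> admits both orders of the two remaining
  vertices, so the angle has to be known for both.\<close>

lemma inner_angle_eq:
  assumes angle: "\<And>\<theta>. triangle_angle g (edge_length g \<epsilon> \<eta> f i j) (edge_length g \<epsilon> \<eta> f i k) (edge_length g \<epsilon> \<eta> f j k) \<theta> \<longleftrightarrow> \<theta> = \<theta>\<^sub>0"
    "\<And>\<theta>. triangle_angle g (edge_length g \<epsilon> \<eta> f i k) (edge_length g \<epsilon> \<eta> f i j) (edge_length g \<epsilon> \<eta> f k j) \<theta> \<longleftrightarrow> \<theta> = \<theta>\<^sub>0"
    and distinct: "i \<noteq> j" "i \<noteq> k" "j \<noteq> k"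
  shows "inner_angle g \<epsilon> \<eta> f {i, j, k} i = \<theta>\<^sub>0"
proof -
  let ?l = "edge_length g \<epsilon> \<eta> f"
  have "(\<exists>j' k'. {i, j, k} = {i, j', k'} \<and> triangle_angle g (?l i j') (?l i k') (?l j' k') \<theta>) \<longleftrightarrow> \<theta> = \<theta>\<^sub>0" for \<theta>
  proof
    assume "\<exists>j' k'. {i, j, k} = {i, j', k'} \<and> triangle_angle g (?l i j') (?l i k') (?l j' k') \<theta>"
    then obtain j' k' where *: "{i, j, k} = {i, j', k'}" and \<theta>: "triangle_angle g (?l i j') (?l i k') (?l j' k') \<theta>"
      by blast
    have "{j, k} = {i, j, k} - {i}" "{i, j', k'} - {i} \<subseteq> {j', k'}" using distinct by auto
    then have "{j, k} \<subseteq> {j', k'}" unfolding * by simp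
    then have "(j' = j \<and> k' = k) \<or> (j' = k \<and> k' = j)" using distinct(3) by auto
    then show "\<theta> = \<theta>\<^sub>0" using \<theta> angle[of \<theta>] by auto
  next
    assume "\<theta> = \<theta>\<^sub>0"
    then have "triangle_angle g (?l i j) (?l i k) (?l j k) \<theta>" using angle(1) by simp
    then show "\<exists>j' k'. {i, j, k} = {i, j', k'} \<and> triangle_angle g (?l i j') (?l i k') (?l j' k') \<theta>"
      by (intro exI[of _ j] exI[of _ k] conjI refl)
  qed
  then show ?thesis unfolding inner_angle_def by simp
qed

lemma edge_length_commute: "edge_length g \<epsilon> \<eta> f i j = edge_length g \<epsilon> \<eta> f j i"
  by (cases g) (simp_all add: insert_commute mult.commute add_ac)

lemma discrete_conformal_structure_triangle:
  assumes "discrete_conformal_structure g F \<epsilon> \<eta> f" "{i, j, k} \<in> F"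
  defines "l \<equiv> edge_length g \<epsilon> \<eta> f"
  shows "l i j > 0" "l i k > 0" "l j k > 0" "l j k < l i j + l i k" "l i j < l i k + l j k" "l i k < l i j + l j k"
proof -
  have *: "0 < l x y \<and> l x y < l x z + l y z" if "{x, y, z} = {i, j, k}" for x y z
    using assms(1,2) that unfolding discrete_conformal_structure_def l_def by metis
  have "{i, k, j} = {i, j, k}" "{j, k, i} = {i, j, k}" by auto
  with *[of i j k] *[of i k j] *[of j k i]
  show "l i j > 0" "l i k > 0" "l j k > 0" "l j k < l i j + l i k" "l i j < l i k + l j k" "l i k < l i j + l j k"
    using edge_length_commute[of g \<epsilon> \<eta> f] unfolding l_def by metis+
qed

lemma inner_angle_Euclidean:
  assumes "discrete_conformal_structure Euclidean F \<epsilon> \<eta> f" "{i, j, k} \<in> F" "i \<noteq> j" "i \<noteq> k" "j \<noteq> k"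
  defines "L \<equiv> \<lambda>x y. (edge_length Euclidean \<epsilon> \<eta> f x y)\<^sup>2"
  shows "inner_angle Euclidean \<epsilon> \<eta> f {i, j, k} i = clamped_angle (L i j + L i k - L j k) (4 * L i j * L i k)"
proof (rule inner_angle_eq)
  let ?l = "edge_length Euclidean \<epsilon> \<eta> f"
  note T = discrete_conformal_structure_triangle[OF assms(1,2)]
  fix \<theta>
  show "triangle_angle Euclidean (?l i j) (?l i k) (?l j k) \<theta> \<longleftrightarrow>
     \<theta> = clamped_angle (L i j + L i k - L j k) (4 * L i j * L i k)"
    unfolding L_def using T by (intro triangle_angle_Euclidean_iff) linarith+
  have "triangle_angle Euclidean (?l i k) (?l i j) (?l k j) \<theta> \<longleftrightarrow>
     \<theta> = clamped_angle ((?l i k)\<^sup>2 + (?l i j)\<^sup>2 - (?l k j)\<^sup>2) (4 * (?l i k)\<^sup>2 * (?l i j)\<^sup>2)"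
    unfolding edge_length_commute[of _ _ _ _ k j] using T by (intro triangle_angle_Euclidean_iff) linarith+
  then show "triangle_angle Euclidean (?l i k) (?l i j) (?l k j) \<theta> \<longleftrightarrow>
     \<theta> = clamped_angle (L i j + L i k - L j k) (4 * L i j * L i k)"
    unfolding L_def edge_length_commute[of _ _ _ _ k j] by (simp only: mult_ac add_ac)
qed fact+

lemma inner_angle_Hyperbolic:
  assumes "discrete_conformal_structure Hyperbolic F \<epsilon> \<eta> f" "{i, j, k} \<in> F" "i \<noteq> j" "i \<noteq> k" "j \<noteq> k"
  defines "C \<equiv> \<lambda>x y. cosh (edge_length Hyperbolic \<epsilon> \<eta> f x y)"
  shows "inner_angle Hyperbolic \<epsilon> \<eta> f {i, j, k} i =
    clamped_angle (C i j * C i k - C j k) (((C i j)\<^sup>2 - 1) * ((C i k)\<^sup>2 - 1))"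
proof (rule inner_angle_eq)
  let ?l = "edge_length Hyperbolic \<epsilon> \<eta> f"
  note T = discrete_conformal_structure_triangle[OF assms(1,2)]
  fix \<theta>
  show "triangle_angle Hyperbolic (?l i j) (?l i k) (?l j k) \<theta> \<longleftrightarrow>
     \<theta> = clamped_angle (C i j * C i k - C j k) (((C i j)\<^sup>2 - 1) * ((C i k)\<^sup>2 - 1))"
    unfolding C_def using T by (intro triangle_angle_Hyperbolic_iff) linarith+
  have "triangle_angle Hyperbolic (?l i k) (?l i j) (?l k j) \<theta> \<longleftrightarrow>
     \<theta> = clamped_angle (C i k * C i j - C k j) (((C i k)\<^sup>2 - 1) * ((C i j)\<^sup>2 - 1))"
    unfolding C_def edge_length_commute[of _ _ _ _ k j] using T by (intro triangle_angle_Hyperbolic_iff) linarith+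
  then show "triangle_angle Hyperbolic (?l i k) (?l i j) (?l k j) \<theta> \<longleftrightarrow>
     \<theta> = clamped_angle (C i j * C i k - C j k) (((C i j)\<^sup>2 - 1) * ((C i k)\<^sup>2 - 1))"
    unfolding C_def edge_length_commute[of _ _ _ _ k j] by (simp only: mult.commute)
qed fact+

section \<open>Rigidity\<close>

text \<open>The quantities \<open>exp f\<close> and \<open>sqrt (1 + e * exp (2 * f))\<close> in terms of the conformal coordinate
  \<open>u\<close>; for \<open>e = 1\<close> they are meaningful only if \<open>u < 0\<close>.\<close>

definition hyp_radius :: "real \<Rightarrow> real \<Rightarrow> real" where
  "hyp_radius e u = (if e = 0 then exp u else - 1 / sinh u)"

definition hyp_height :: "real \<Rightarrow> real \<Rightarrow> real" where
  "hyp_height e u = (if e = 0 then 1 else - cosh u / sinh u)"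

lemma hyp_radius_height:
  assumes "e \<in> {0, 1}" "e = 1 \<Longrightarrow> u < 0"
  shows "hyp_radius e u > 0" "hyp_height e u > 0" "(hyp_height e u)\<^sup>2 = 1 + e * (hyp_radius e u)\<^sup>2"
proof -
  have "sinh u < 0" if "e = 1" using assms(2)[OF that] by simp
  then show "hyp_radius e u > 0" "hyp_height e u > 0" "(hyp_height e u)\<^sup>2 = 1 + e * (hyp_radius e u)\<^sup>2"
    using assms(1)
    by (auto simp: hyp_radius_def hyp_height_def power_divide cosh_square_eq add_divide_distrib intro: divide_pos_neg)
qed

lemma DERIV_hyp_radius_height:
  fixes u d :: real
  assumes "e \<in> {0, 1}" "e = 1 \<Longrightarrow> u + t * d < 0"
  shows "((\<lambda>t. hyp_radius e (u + t * d)) has_real_derivative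
      hyp_radius e (u + t * d) * hyp_height e (u + t * d) * d) (at t)" (is ?r)
    and "((\<lambda>t. hyp_height e (u + t * d)) has_real_derivative e * (hyp_radius e (u + t * d))\<^sup>2 * d) (at t)" (is ?h)
proof -
  have "?r \<and> ?h"
  proof (cases "e = 0")
    case True
    then show ?thesis unfolding hyp_radius_def hyp_height_def
      by (auto intro!: derivative_eq_intros)
  next
    case False
    then have e: "e = 1" using assms by simp
    have s: "sinh (u + t * d) < 0" using assms(2)[OF e] by simp
    then have "sinh (u + t * d) \<noteq> 0" by simp
    moreover have "(cosh (u + t * d))\<^sup>2 = (sinh (u + t * d))\<^sup>2 + 1" by (rule cosh_square_eq)
    ultimately show ?thesis unfolding hyp_radius_def hyp_height_def e
      by (auto intro!: derivative_eq_intros simp: field_simps power2_eq_square)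
  qed
  then show ?r ?h by auto
qed

text \<open>For a vertex circle of radius \<rho>, where \<open>exp (f i)\<close> is
  \<open>sinh \<rho>\<close>, the coordinate is \<open>ln (tanh (\<rho> / 2))\<close>. It is
  therefore negative, and \<open>sinh \<rho> = - 1 / sinh u\<close>. In the proof \<open>w\<close>
  is \<open>cosh \<rho>\<close> and \<open>z\<close> is the square of
  \<open>tanh (\<rho> / 2)\<close>.\<close>

lemma conformal_coord_Hyperbolic:
  fixes \<epsilon> f :: "'v \<Rightarrow> real" and i :: 'v
  assumes "\<epsilon> i \<in> {0, 1}"
  defines "u \<equiv> conformal_coord Hyperbolic \<epsilon> f i"
  shows "\<epsilon> i = 1 \<Longrightarrow> u < 0" "hyp_radius (\<epsilon> i) u = exp (f i)"
    "hyp_height (\<epsilon> i) u = sqrt (1 + \<epsilon> i * exp (2 * f i))"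
proof -
  have 1: "u < 0 \<and> (hyp_radius (\<epsilon> i) u)\<^sup>2 = (exp (f i))\<^sup>2" if e: "\<epsilon> i = 1"
  proof -
    define w where "w = sqrt (1 + exp (2 * f i))"
    have w: "w > 1" "w\<^sup>2 = 1 + (exp (f i))\<^sup>2" unfolding w_def by (simp_all add: exp_double)
    define z where "z = (w - 1) / (w + 1)"
    have z: "0 < z" "z < 1" using w by (simp_all add: z_def)
    have u: "u = ln z / 2" using e z unfolding u_def z_def w_def by simp
    moreover have "ln z < 0" using z by simp
    ultimately have "u < 0" by simp
    have uz: "(exp u)\<^sup>2 = z" using z unfolding u by (simp flip: exp_double)
    have sinh: "- 1 / ((x - 1 / x) / 2) = 2 * x / (1 - x\<^sup>2)" if "x > 0" for x :: real
    proof -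
      have eq: "(x - 1 / x) / 2 = - (1 - x\<^sup>2) / (2 * x)"
        using that by (simp add: divide_simps power2_eq_square)
      have "- 1 / (- p / q) = q / p" for p q :: real by simp
      then show ?thesis unfolding eq .
    qed
    have "hyp_radius (\<epsilon> i) u = - 1 / ((exp u - 1 / exp u) / 2)"
      by (simp only: hyp_radius_def e sinh_field_def exp_minus inverse_eq_divide) simp
    also have "\<dots> = 2 * exp u / (1 - (exp u)\<^sup>2)" by (rule sinh) simp
    finally have "(hyp_radius (\<epsilon> i) u)\<^sup>2 = 4 * z / (1 - z)\<^sup>2"
      by (simp add: power_divide power_mult_distrib uz)
    also have "\<dots> = w\<^sup>2 - 1"
    proof -
      have "1 - z = 2 / (w + 1)" using w by (simp add: z_def field_simps)
      then show ?thesis using w unfolding z_def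
        by (simp add: power_divide divide_simps) (simp add: power2_eq_square algebra_simps)
    qed
    finally show ?thesis using \<open>u < 0\<close> w by simp
  qed
  then show neg: "u < 0" if "\<epsilon> i = 1" using that by simp
  have RH: "hyp_radius (\<epsilon> i) u > 0" "hyp_height (\<epsilon> i) u > 0"
    "(hyp_height (\<epsilon> i) u)\<^sup>2 = 1 + \<epsilon> i * (hyp_radius (\<epsilon> i) u)\<^sup>2"
    by (rule hyp_radius_height[OF assms(1) neg], assumption)+
  show r: "hyp_radius (\<epsilon> i) u = exp (f i)"
  proof (cases "\<epsilon> i = 0")
    case True
    then show ?thesis by (simp add: hyp_radius_def u_def)
  next
    case False
    then show ?thesis using 1 RH(1) assms(1) by (simp add: power2_eq_iff_nonneg)
  qed
  have "(hyp_height (\<epsilon> i) u)\<^sup>2 = 1 + \<epsilon> i * exp (2 * f i)"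
    unfolding RH(3) r by (simp add: exp_double)
  then show "hyp_height (\<epsilon> i) u = sqrt (1 + \<epsilon> i * exp (2 * f i))"
    using RH(2) by (metis less_eq_real_def real_sqrt_unique)
qed

text \<open>Multiplication by the square of \<alpha> turns the left-hand side into
  \<open>\<alpha> * R\<close> times the product of an increment of \<open>exp\<close> and the
  increment of its argument, which have the same sign.\<close>

lemma exp_monotone:
  fixes \<alpha> u v R :: real
  assumes "\<alpha> * R \<le> 0"
  shows "(R * exp (\<alpha> * v) - R * exp (\<alpha> * u)) * (v - u) \<le> 0"
    and "\<alpha> * R \<noteq> 0 \<Longrightarrow> u \<noteq> v \<Longrightarrow> (R * exp (\<alpha> * v) - R * exp (\<alpha> * u)) * (v - u) < 0"
proof -
  have strict: "\<alpha> * R * ((exp (\<alpha> * v) - exp (\<alpha> * u)) * (\<alpha> * v - \<alpha> * u)) < 0" if "\<alpha> * R \<noteq> 0" "u \<noteq> v"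
  proof -
    have "\<alpha> * v \<noteq> \<alpha> * u" using that by auto
    then have "(exp (\<alpha> * v) - exp (\<alpha> * u)) * (\<alpha> * v - \<alpha> * u) > 0"
      by (cases "\<alpha> * v" "\<alpha> * u" rule: linorder_cases) (auto intro: mult_pos_pos mult_neg_neg)
    moreover have "\<alpha> * R < 0" using that assms by linarith
    ultimately show ?thesis by (rule mult_neg_pos[rotated])
  qed
  have eq: "\<alpha> * R * ((exp (\<alpha> * v) - exp (\<alpha> * u)) * (\<alpha> * v - \<alpha> * u))
    = \<alpha>\<^sup>2 * ((R * exp (\<alpha> * v) - R * exp (\<alpha> * u)) * (v - u))"
    by (simp add: power2_eq_square algebra_simps)
  show lt: "(R * exp (\<alpha> * v) - R * exp (\<alpha> * u)) * (v - u) < 0" if "\<alpha> * R \<noteq> 0" "u \<noteq> v"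
    using strict[OF that] unfolding eq by (simp add: mult_less_0_iff)
  show "(R * exp (\<alpha> * v) - R * exp (\<alpha> * u)) * (v - u) \<le> 0"
  proof (cases "\<alpha> * R \<noteq> 0 \<and> u \<noteq> v")
    case True
    then show ?thesis using lt by simp
  qed auto
qed

section \<open>Passage from single faces to the whole surface\<close>

lemma sum_nonpos_eq_0D:
  fixes f :: "'b \<Rightarrow> real"
  assumes "finite A" "\<And>x. x \<in> A \<Longrightarrow> f x \<le> 0" "sum f A = 0" "x \<in> A"
  shows "f x = 0"
  using sum_nonneg_eq_0_iff[of A "\<lambda>x. - f x"] assms by (simp add: sum_negf)

text \<open>The piecewise linear extension of \<open>\<delta>\<close> is continuous and takes finitely many values.\<close>

lemma constant_of_connected_realization:
  fixes V :: "'v set" and F :: "'v set set" and \<delta> :: "'v \<Rightarrow> real"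
  assumes "finite V" "V = \<Union>F" "connected (realization F)"
    and const: "\<And>T x y. T \<in> F \<Longrightarrow> x \<in> T \<Longrightarrow> y \<in> T \<Longrightarrow> \<delta> x = \<delta> y"
  shows "\<exists>k. \<forall>x\<in>V. \<delta> x = k"
proof -
  define \<Phi> where "\<Phi> p = (\<Sum>x\<in>V. p x * \<delta> x)" for p :: "'v \<Rightarrow> real"
  have face: "\<Phi> p = \<delta> x" if "T \<in> F" "\<forall>i. i \<notin> T \<longrightarrow> p i = 0" "(\<Sum>i\<in>T. p i) = 1" "x \<in> T" for T p x
  proof -
    have "\<Phi> p = (\<Sum>y\<in>T. p y * \<delta> y)" unfolding \<Phi>_def
      using that assms(1,2) by (intro sum.mono_neutral_right) auto
    also have "\<dots> = (\<Sum>y\<in>T. p y * \<delta> x)"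
      using const[OF that(1) _ that(4)] by (intro sum.cong) auto
    also have "\<dots> = \<delta> x" using that(3) by (simp flip: sum_distrib_right)
    finally show ?thesis .
  qed
  have "\<Phi> ` realization F \<subseteq> \<delta> ` V"
  proof
    fix y assume "y \<in> \<Phi> ` realization F"
    then obtain p T where pT: "y = \<Phi> p" "T \<in> F" "\<forall>i. i \<notin> T \<longrightarrow> p i = 0" "(\<Sum>i\<in>T. p i) = 1"
      by (auto simp: realization_def)
    then obtain x where "x \<in> T" by force
    then show "y \<in> \<delta> ` V" using face[OF pT(2-4)] pT assms(2) by auto
  qed
  then have "finite (\<Phi> ` realization F)" using assms(1) by (meson finite_imageI finite_subset)
  moreover have "continuous_on (realization F) \<Phi>" unfolding \<Phi>_def
    by (intro continuous_on_sum continuous_on_mult_right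
        continuous_on_subset[OF continuous_on_product_coordinates subset_UNIV])
  then have "connected (\<Phi> ` realization F)" using assms(3) by (rule connected_continuous_image)
  ultimately obtain k where k: "\<Phi> ` realization F \<subseteq> {k}"
    using connected_finite_iff_sing by (metis empty_subsetI order_refl)
  have "\<delta> x = k" if "x \<in> V" for x
  proof -
    obtain T where T: "T \<in> F" "x \<in> T" using \<open>x \<in> V\<close> assms(2) by blast
    have fin: "finite T" using T(1) assms(1,2) by (auto intro: finite_subset)
    let ?p = "\<lambda>i. if i = x then 1 else 0 :: real"
    have s: "(\<Sum>i\<in>T. ?p i) = 1" using T(2) fin by simp
    then have "?p \<in> realization F" using T unfolding realization_def by (auto intro!: bexI[of _ T])
    moreover have "\<Phi> ?p = \<delta> x" using T s by (intro face[of T]) auto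
    ultimately show ?thesis using k by auto
  qed
  then show ?thesis by blast
qed

lemma surface_triangulation_connected:
  assumes "connected_space M" "surface_triangulation M V E F"
  shows "connected (realization F)"
proof -
  have "top_of_set (realization F) homeomorphic_space M"
    using assms(2) by (simp add: surface_triangulation_def)
  then have "connected_space (top_of_set (realization F))"
    using assms(1) homeomorphic_connected_space by blast
  then show ?thesis by (simp add: connectedin_def flip: connectedin_iff_connected)
qed

locale weighted_triangulation =
  fixes V :: "'v set" and F :: "'v set set" and \<epsilon> :: "'v \<Rightarrow> real" and \<eta> :: "'v set \<Rightarrow> real"
  assumes fin: "finite V" and VF: "V = \<Union>F" and card_face: "T \<in> F \<Longrightarrow> card T = 3"
    and eps: "i \<in> V \<Longrightarrow> \<epsilon> i \<in> {0, 1}"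
    and edge: "{s, t, q} \<in> F \<Longrightarrow> s \<noteq> t \<Longrightarrow> \<epsilon> s * \<epsilon> t + \<eta> {s, t} > 0"
    and gamma: "{q, s, t} \<in> F \<Longrightarrow> \<epsilon> q * \<eta> {s, t} + \<eta> {q, s} * \<eta> {q, t} \<ge> 0"
begin

lemma finF: "finite F" and finite_face: "T \<in> F \<Longrightarrow> finite T"
proof -
  show "finite F" using fin VF by (metis finite_UnionD)
  show "finite T" if "T \<in> F" using card_face[OF that] by (simp add: card_ge_0_finite)
qed

lemma face_weights:
  assumes F: "{i, j, k} \<in> F" and "i \<noteq> j" "i \<noteq> k" "j \<noteq> k"
  shows "face_weights (\<epsilon> i) (\<epsilon> j) (\<epsilon> k) (\<eta> {j, k}) (\<eta> {i, k}) (\<eta> {i, j})"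
proof
  have perm: "{j, k, i} = {i, j, k}" "{i, k, j} = {i, j, k}" "{j, i, k} = {i, j, k}" "{k, i, j} = {i, j, k}" by auto
  show "\<epsilon> i \<in> {0, 1}" "\<epsilon> j \<in> {0, 1}" "\<epsilon> k \<in> {0, 1}" using F VF by (auto intro!: eps simp del: insert_iff)
  show "\<epsilon> j * \<epsilon> k + \<eta> {j, k} > 0" "\<epsilon> i * \<epsilon> k + \<eta> {i, k} > 0" "\<epsilon> i * \<epsilon> j + \<eta> {i, j} > 0"
    using edge[of j k i] edge[of i k j] edge[of i j k] assms unfolding perm by auto
  show "\<epsilon> i * \<eta> {j, k} + \<eta> {i, k} * \<eta> {i, j} \<ge> 0" "\<epsilon> j * \<eta> {i, k} + \<eta> {j, k} * \<eta> {i, j} \<ge> 0"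
    "\<epsilon> k * \<eta> {i, j} + \<eta> {j, k} * \<eta> {i, k} \<ge> 0"
    using gamma[of i j k] gamma[of j i k] gamma[of k i j] assms unfolding perm
    by (simp_all add: insert_commute mult.commute)
qed

lemma face_cases:
  assumes "T \<in> F"
  obtains i j k where "T = {i, j, k}" "i \<noteq> j" "i \<noteq> k" "j \<noteq> k"
  using card_face[OF assms] by (auto simp: card_3_iff)

lemma euc_face_decreasing:
  assumes f: "discrete_conformal_structure Euclidean F \<epsilon> \<eta> f" and g: "discrete_conformal_structure Euclidean F \<epsilon> \<eta> g"
    and "T \<in> F" and nc: "\<not> (\<forall>x\<in>T. \<forall>y\<in>T. g x - f x = g y - f y)"
  shows "(\<Sum>x\<in>T. (g x - f x) * (inner_angle Euclidean \<epsilon> \<eta> g T x - inner_angle Euclidean \<epsilon> \<eta> f T x)) < 0"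
proof -
  obtain i j k where T: "T = {i, j, k}" and ne: "i \<noteq> j" "i \<noteq> k" "j \<noteq> k" using face_cases[OF \<open>T \<in> F\<close>] .
  have TF: "{i, j, k} \<in> F" "{i, k, j} \<in> F" "{j, i, k} \<in> F" "{k, j, i} \<in> F"
    using \<open>T \<in> F\<close> unfolding T by (simp_all add: insert_commute)
  interpret W: face_weights "\<epsilon> i" "\<epsilon> j" "\<epsilon> k" "\<eta> {j, k}" "\<eta> {i, k}" "\<eta> {i, j}"
    using TF(1) ne by (rule face_weights)
  \<comment> \<open>The straight segment in the Euclidean conformal coordinate, which is the
    logarithm of the radius.\<close>
  define r where "r x t = exp (f x + t * (g x - f x))" for x t
  define L where "L x y t = \<epsilon> x * (r x t)\<^sup>2 + \<epsilon> y * (r y t)\<^sup>2 + 2 * \<eta> {x, y} * (r x t * r y t)" for x y t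
  have Lc: "L x y = L y x" for x y by (simp add: L_def fun_eq_iff insert_commute)
  have r: "r x t > 0" "(r x has_real_derivative r x t * (g x - f x)) (at t)" for x t
    unfolding r_def by (auto intro!: derivative_eq_intros)
  have r01: "r x 0 = exp (f x)" "r x 1 = exp (g x)" for x by (simp_all add: r_def)
  have Lpos: "L x y t > 0" if "{x, y} \<in> {{i, j}, {i, k}, {j, k}}" for x y t
    using euc_edge_pos[OF W.eps(2,3) W.edge(1) r(1)[of j t] r(1)[of k t]]
      euc_edge_pos[OF W.eps(1,3) W.edge(2) r(1)[of i t] r(1)[of k t]]
      euc_edge_pos[OF W.eps(1,2) W.edge(3) r(1)[of i t] r(1)[of j t]] that Lc
    by (auto simp: doubleton_eq_iff L_def insert_commute add_ac mult_ac)
  have len: "(edge_length Euclidean \<epsilon> \<eta> f x y)\<^sup>2 = L x y 0" "(edge_length Euclidean \<epsilon> \<eta> g x y)\<^sup>2 = L x y 1"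
    if "{x, y} \<in> {{i, j}, {i, k}, {j, k}}" for x y
    using Lpos[OF that, of 0] Lpos[OF that, of 1] unfolding L_def r01
    by (simp_all add: exp_add exp_double)
  \<comment> \<open>Vertices \<open>i\<close>, \<open>j\<close>, \<open>k\<close> take the roles 1,
    2, 3, so \<open>L j k\<close> is the squared side opposite to vertex 1; the sides are listed in
    the cyclic order of \<open>euc_angle_sum_decreasing\<close>.\<close>
  have angle:
    "inner_angle Euclidean \<epsilon> \<eta> f T i = clamped_angle (L i k 0 + L i j 0 - L j k 0) (4 * L i k 0 * L i j 0)"
    "inner_angle Euclidean \<epsilon> \<eta> f T j = clamped_angle (L i j 0 + L j k 0 - L i k 0) (4 * L i j 0 * L j k 0)"
    "inner_angle Euclidean \<epsilon> \<eta> f T k = clamped_angle (L j k 0 + L i k 0 - L i j 0) (4 * L j k 0 * L i k 0)"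
    "inner_angle Euclidean \<epsilon> \<eta> g T i = clamped_angle (L i k 1 + L i j 1 - L j k 1) (4 * L i k 1 * L i j 1)"
    "inner_angle Euclidean \<epsilon> \<eta> g T j = clamped_angle (L i j 1 + L j k 1 - L i k 1) (4 * L i j 1 * L j k 1)"
    "inner_angle Euclidean \<epsilon> \<eta> g T k = clamped_angle (L j k 1 + L i k 1 - L i j 1) (4 * L j k 1 * L i k 1)"
    using inner_angle_Euclidean[OF f TF(2)] inner_angle_Euclidean[OF f TF(3)] inner_angle_Euclidean[OF f TF(4)]
      inner_angle_Euclidean[OF g TF(2)] inner_angle_Euclidean[OF g TF(3)] inner_angle_Euclidean[OF g TF(4)] ne
    by (simp_all add: len Lc[of k j] Lc[of j i] Lc[of k i] T insert_commute del: edge_length.simps)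
  have D0: "2 * (L j k 0 * L i k 0 + L i k 0 * L i j 0 + L i j 0 * L j k 0) - (L j k 0)\<^sup>2 - (L i k 0)\<^sup>2 - (L i j 0)\<^sup>2 > 0"
  proof -
    note tri = discrete_conformal_structure_triangle[OF f TF(1)]
    have "(L i j 0 + L i k 0 - L j k 0)\<^sup>2 < 4 * L i j 0 * L i k 0"
      using euc_triangle_discriminant[OF tri(1,2,3,4)] tri(5,6) by (simp add: len add_ac del: edge_length.simps)
    then show ?thesis by (simp add: power2_eq_square algebra_simps)
  qed
  have "(g i - f i) * inner_angle Euclidean \<epsilon> \<eta> g T i + (g j - f j) * inner_angle Euclidean \<epsilon> \<eta> g T j
       + (g k - f k) * inner_angle Euclidean \<epsilon> \<eta> g T k
     < (g i - f i) * inner_angle Euclidean \<epsilon> \<eta> f T i + (g j - f j) * inner_angle Euclidean \<epsilon> \<eta> f T j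
       + (g k - f k) * inner_angle Euclidean \<epsilon> \<eta> f T k"
    unfolding angle L_def
  proof (rule W.euc_angle_sum_decreasing)
    show "\<not> (g i - f i = g j - f j \<and> g j - f j = g k - f k)" using nc unfolding T by auto
  qed (use D0 r in \<open>simp_all add: L_def\<close>)
  then show ?thesis unfolding T using ne by (simp add: algebra_simps)
qed

text \<open>Covers the case excluded in \<open>euc_face_decreasing\<close>: adding a constant
  multiplies all lengths by \<open>exp c\<close>, and the cosine in the law of cosines is
  homogeneous of degree 0.\<close>

lemma euc_face_similar:
  assumes f: "discrete_conformal_structure Euclidean F \<epsilon> \<eta> f" and g: "discrete_conformal_structure Euclidean F \<epsilon> \<eta> g"
    and "T \<in> F" and c: "\<And>x. x \<in> T \<Longrightarrow> g x = f x + c" and "x \<in> T"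
  shows "inner_angle Euclidean \<epsilon> \<eta> g T x = inner_angle Euclidean \<epsilon> \<eta> f T x"
proof -
  obtain y z where T: "T = {x, y, z}" and ne: "x \<noteq> y" "x \<noteq> z" "y \<noteq> z"
  proof -
    obtain i j k where "T = {i, j, k}" "i \<noteq> j" "i \<noteq> k" "j \<noteq> k" using face_cases[OF \<open>T \<in> F\<close>] .
    then show thesis using \<open>x \<in> T\<close> that[of j k] that[of i k] that[of i j] by (auto simp: insert_commute)
  qed
  have len: "(edge_length Euclidean \<epsilon> \<eta> g p q)\<^sup>2 = (exp c)\<^sup>2 * (edge_length Euclidean \<epsilon> \<eta> f p q)\<^sup>2" if "p \<in> T" "q \<in> T" for p q
  proof -
    have "\<epsilon> p * exp (2 * g p) + \<epsilon> q * exp (2 * g q) + 2 * \<eta> {p, q} * exp (g p + g q)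
      = (exp c)\<^sup>2 * (\<epsilon> p * exp (2 * f p) + \<epsilon> q * exp (2 * f q) + 2 * \<eta> {p, q} * exp (f p + f q))"
      unfolding c[OF that(1)] c[OF that(2)] exp_double exp_add by algebra
    then have "edge_length Euclidean \<epsilon> \<eta> g p q = exp c * edge_length Euclidean \<epsilon> \<eta> f p q"
      by (simp only: edge_length.simps real_sqrt_mult) simp
    then show ?thesis by (simp only: power_mult_distrib)
  qed
  have scale: "clamped_angle (s\<^sup>2 * A + s\<^sup>2 * B - s\<^sup>2 * C) (4 * (s\<^sup>2 * A) * (s\<^sup>2 * B)) = clamped_angle (A + B - C) (4 * A * B)"
    if "s > 0" for s A B C :: real
  proof -
    have "4 * (s\<^sup>2 * A) * (s\<^sup>2 * B) = (s\<^sup>2)\<^sup>2 * (4 * A * B)" by algebra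
    then have "sqrt (4 * (s\<^sup>2 * A) * (s\<^sup>2 * B)) = s\<^sup>2 * sqrt (4 * A * B)"
      by (simp only: real_sqrt_mult[of "(s\<^sup>2)\<^sup>2"] real_sqrt_abs abs_power2)
    moreover have "s\<^sup>2 * A + s\<^sup>2 * B - s\<^sup>2 * C = s\<^sup>2 * (A + B - C)" by algebra
    ultimately show ?thesis unfolding clamped_angle_def using that by simp
  qed
  have F: "{x, y, z} \<in> F" using \<open>T \<in> F\<close> T by simp
  have xyz: "x \<in> T" "y \<in> T" "z \<in> T" unfolding T by auto
  note len_xyz = len[OF xyz(1,2)] len[OF xyz(1,3)] len[OF xyz(2,3)]
  show ?thesis
    unfolding T inner_angle_Euclidean[OF f F ne] inner_angle_Euclidean[OF g F ne]
    by (simp only: len_xyz scale[OF exp_gt_zero])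
qed

lemma hyp_face_decreasing:
  assumes f: "discrete_conformal_structure Hyperbolic F \<epsilon> \<eta> f" and g: "discrete_conformal_structure Hyperbolic F \<epsilon> \<eta> g"
    and "T \<in> F"
  defines "\<delta> \<equiv> \<lambda>x. conformal_coord Hyperbolic \<epsilon> g x - conformal_coord Hyperbolic \<epsilon> f x"
  assumes nc: "\<not> (\<forall>x\<in>T. \<delta> x = 0)"
  shows "(\<Sum>x\<in>T. \<delta> x * (inner_angle Hyperbolic \<epsilon> \<eta> g T x - inner_angle Hyperbolic \<epsilon> \<eta> f T x)) < 0"
proof -
  let ?u = "conformal_coord Hyperbolic \<epsilon> f" and ?v = "conformal_coord Hyperbolic \<epsilon> g"
  obtain i j k where T: "T = {i, j, k}" and ne: "i \<noteq> j" "i \<noteq> k" "j \<noteq> k" using face_cases[OF \<open>T \<in> F\<close>] .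
  have TF: "{i, j, k} \<in> F" "{i, k, j} \<in> F" "{j, i, k} \<in> F" "{k, j, i} \<in> F"
    using \<open>T \<in> F\<close> unfolding T by (simp_all add: insert_commute)
  interpret W: face_weights "\<epsilon> i" "\<epsilon> j" "\<epsilon> k" "\<eta> {j, k}" "\<eta> {i, k}" "\<eta> {i, j}"
    using TF(1) ne by (rule face_weights)
  define r where "r x t = hyp_radius (\<epsilon> x) (?u x + t * \<delta> x)" for x t
  define h where "h x t = hyp_height (\<epsilon> x) (?u x + t * \<delta> x)" for x t
  define C where "C x y t = h x t * h y t + \<eta> {x, y} * (r x t * r y t)" for x y t
  have Cc: "C x y = C y x" for x y by (simp add: C_def fun_eq_iff insert_commute)
  \<comment> \<open>The negative half-line is convex, so the whole segment stays where radius and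
    height of a vertex circle are meaningful, whether or not the triangle inequalities hold.\<close>
  have neg: "?u x + t * \<delta> x < 0" if "\<epsilon> x = 1" "t \<in> {0..1}" for x t
  proof -
    have uv: "?u x < 0" "?v x < 0" using conformal_coord_Hyperbolic(1)[of \<epsilon> x] that by simp_all
    have "?u x + t * \<delta> x = (1 - t) * ?u x + t * ?v x" by (simp add: \<delta>_def algebra_simps)
    also have "\<dots> < 0"
    proof (cases "t = 0")
      case False
      then have "t * ?v x < 0" "(1 - t) * ?u x \<le> 0"
        using uv that by (auto intro: mult_pos_neg mult_nonneg_nonpos)
      then show ?thesis by linarith
    qed (use uv in simp)
    finally show ?thesis .
  qed
  have rh: "r x t > 0" "h x t > 0" "(h x t)\<^sup>2 = 1 + \<epsilon> x * (r x t)\<^sup>2"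
    "(r x has_real_derivative r x t * h x t * \<delta> x) (at t)"
    "(h x has_real_derivative \<epsilon> x * (r x t)\<^sup>2 * \<delta> x) (at t)"
    if "x \<in> {i, j, k}" "t \<in> {0..1}" for x t
  proof -
    have e: "\<epsilon> x \<in> {0, 1}" using that(1) W.eps by (auto simp del: insert_iff simp: insert_iff[of x])
    have n: "\<epsilon> x = 1 \<Longrightarrow> ?u x + t * \<delta> x < 0" using neg that(2) by blast
    show "r x t > 0" unfolding r_def by (rule hyp_radius_height(1)[OF e n])
    show "h x t > 0" unfolding h_def by (rule hyp_radius_height(2)[OF e n])
    show "(h x t)\<^sup>2 = 1 + \<epsilon> x * (r x t)\<^sup>2" unfolding r_def h_def by (rule hyp_radius_height(3)[OF e n])
    show "(r x has_real_derivative r x t * h x t * \<delta> x) (at t)"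
      unfolding r_def h_def by (rule DERIV_hyp_radius_height(1)[OF e n])
    show "(h x has_real_derivative \<epsilon> x * (r x t)\<^sup>2 * \<delta> x) (at t)"
      unfolding r_def h_def by (rule DERIV_hyp_radius_height(2)[OF e n])
  qed
  have rh01: "r x 0 = exp (f x)" "h x 0 = sqrt (1 + \<epsilon> x * exp (2 * f x))"
      "r x 1 = exp (g x)" "h x 1 = sqrt (1 + \<epsilon> x * exp (2 * g x))" if "x \<in> {i, j, k}" for x
  proof -
    have e: "\<epsilon> x \<in> {0, 1}" using that(1) W.eps by (auto simp del: insert_iff simp: insert_iff[of x])
    show "r x 0 = exp (f x)" "h x 0 = sqrt (1 + \<epsilon> x * exp (2 * f x))"
      "r x 1 = exp (g x)" "h x 1 = sqrt (1 + \<epsilon> x * exp (2 * g x))"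
      unfolding r_def h_def \<delta>_def using conformal_coord_Hyperbolic(2,3)[of \<epsilon> x f, OF e]
        conformal_coord_Hyperbolic(2,3)[of \<epsilon> x g, OF e]
      by (simp_all del: conformal_coord.simps)
  qed
  have C_gt: "C x y t > 1" if "(x, y) \<in> {(i, j), (i, k), (j, k)}" "t \<in> {0..1}" for x y t
  proof -
    have xy: "x \<in> {i, j, k}" "y \<in> {i, j, k}" using that by auto
    have "\<epsilon> x \<in> {0, 1}" "\<epsilon> y \<in> {0, 1}" using xy W.eps by auto
    moreover have "\<epsilon> x * \<epsilon> y + \<eta> {x, y} > 0" using that(1) W.edge by auto
    ultimately show ?thesis unfolding C_def
      by (rule cosh_edge_gt_1) (rule rh xy that(2))+
  qed
  have len': "cosh (edge_length Hyperbolic \<epsilon> \<eta> f x y) = C x y 0" "cosh (edge_length Hyperbolic \<epsilon> \<eta> g x y) = C x y 1"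
    if "(x, y) \<in> {(i, j), (i, k), (j, k)}" for x y
  proof -
    have xy: "x \<in> {i, j, k}" "y \<in> {i, j, k}" using that by auto
    have "sqrt ((1 + \<epsilon> x * exp (2 * f x)) * (1 + \<epsilon> y * exp (2 * f y))) + \<eta> {x, y} * exp (f x + f y) = C x y 0"
      "sqrt ((1 + \<epsilon> x * exp (2 * g x)) * (1 + \<epsilon> y * exp (2 * g y))) + \<eta> {x, y} * exp (g x + g y) = C x y 1"
      unfolding C_def rh01[OF xy(1)] rh01[OF xy(2)] by (simp_all add: exp_add real_sqrt_mult)
    then show "cosh (edge_length Hyperbolic \<epsilon> \<eta> f x y) = C x y 0" "cosh (edge_length Hyperbolic \<epsilon> \<eta> g x y) = C x y 1"
      using C_gt[OF that, of 0] C_gt[OF that, of 1] by (simp_all add: less_imp_le)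
  qed
  have len: "cosh (edge_length Hyperbolic \<epsilon> \<eta> f x y) = C x y 0" "cosh (edge_length Hyperbolic \<epsilon> \<eta> g x y) = C x y 1"
    if "(x, y) \<in> {(i, j), (i, k), (j, k), (j, i), (k, i), (k, j)}" for x y
    using len'[of x y] len'[of y x] that Cc edge_length_commute[of Hyperbolic \<epsilon> \<eta> f x y]
      edge_length_commute[of Hyperbolic \<epsilon> \<eta> g x y] by (auto simp del: edge_length.simps)
  have angle:
    "inner_angle Hyperbolic \<epsilon> \<eta> f T i = clamped_angle (C i k 0 * C i j 0 - C j k 0) (((C i k 0)\<^sup>2 - 1) * ((C i j 0)\<^sup>2 - 1))"
    "inner_angle Hyperbolic \<epsilon> \<eta> f T j = clamped_angle (C i j 0 * C j k 0 - C i k 0) (((C i j 0)\<^sup>2 - 1) * ((C j k 0)\<^sup>2 - 1))"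
    "inner_angle Hyperbolic \<epsilon> \<eta> f T k = clamped_angle (C j k 0 * C i k 0 - C i j 0) (((C j k 0)\<^sup>2 - 1) * ((C i k 0)\<^sup>2 - 1))"
    "inner_angle Hyperbolic \<epsilon> \<eta> g T i = clamped_angle (C i k 1 * C i j 1 - C j k 1) (((C i k 1)\<^sup>2 - 1) * ((C i j 1)\<^sup>2 - 1))"
    "inner_angle Hyperbolic \<epsilon> \<eta> g T j = clamped_angle (C i j 1 * C j k 1 - C i k 1) (((C i j 1)\<^sup>2 - 1) * ((C j k 1)\<^sup>2 - 1))"
    "inner_angle Hyperbolic \<epsilon> \<eta> g T k = clamped_angle (C j k 1 * C i k 1 - C i j 1) (((C j k 1)\<^sup>2 - 1) * ((C i k 1)\<^sup>2 - 1))"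
    using inner_angle_Hyperbolic[OF f TF(2)] inner_angle_Hyperbolic[OF f TF(3)] inner_angle_Hyperbolic[OF f TF(4)]
      inner_angle_Hyperbolic[OF g TF(2)] inner_angle_Hyperbolic[OF g TF(3)] inner_angle_Hyperbolic[OF g TF(4)] ne
    by (simp_all add: len Cc[of k j] Cc[of j i] Cc[of k i] T insert_commute del: edge_length.simps)
  have D0: "1 + 2 * C j k 0 * C i k 0 * C i j 0 - (C j k 0)\<^sup>2 - (C i k 0)\<^sup>2 - (C i j 0)\<^sup>2 > 0"
  proof -
    note tri = discrete_conformal_structure_triangle[OF f TF(1)]
    have "(C i j 0 * C i k 0 - C j k 0)\<^sup>2 < ((C i j 0)\<^sup>2 - 1) * ((C i k 0)\<^sup>2 - 1)"
      using hyp_triangle_discriminant[OF tri(1,2,3,4)] tri(5,6) by (simp add: len add_ac del: edge_length.simps)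
    then show ?thesis by (simp add: power2_eq_square algebra_simps)
  qed
  have "\<delta> i * inner_angle Hyperbolic \<epsilon> \<eta> g T i + \<delta> j * inner_angle Hyperbolic \<epsilon> \<eta> g T j
       + \<delta> k * inner_angle Hyperbolic \<epsilon> \<eta> g T k
     < \<delta> i * inner_angle Hyperbolic \<epsilon> \<eta> f T i + \<delta> j * inner_angle Hyperbolic \<epsilon> \<eta> f T j
       + \<delta> k * inner_angle Hyperbolic \<epsilon> \<eta> f T k"
    unfolding angle C_def
  proof (rule W.hyp_angle_sum_decreasing)
    show "\<not> (\<delta> i = 0 \<and> \<delta> j = 0 \<and> \<delta> k = 0)" using nc unfolding T by auto
  qed (use D0 in \<open>simp_all add: C_def rh\<close>)
  then show ?thesis unfolding T using ne by (simp add: algebra_simps)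
qed

text \<open>Double counting of pairs of a vertex and a face containing it; the constants
  \<open>2 * pi\<close> cancel.\<close>

lemma angle_sum_swap:
  "(\<Sum>x\<in>V. \<delta> x * (curvature geo F \<epsilon> \<eta> g x - curvature geo F \<epsilon> \<eta> f x))
    = - (\<Sum>T\<in>F. \<Sum>x\<in>T. \<delta> x * (inner_angle geo \<epsilon> \<eta> g T x - inner_angle geo \<epsilon> \<eta> f T x))"
proof -
  let ?D = "\<lambda>x T. \<delta> x * (inner_angle geo \<epsilon> \<eta> g T x - inner_angle geo \<epsilon> \<eta> f T x)"
  have *: "(\<Sum>T | T \<in> F \<and> x \<in> T. ?D x T) = \<delta> x * ((\<Sum>T | T \<in> F \<and> x \<in> T. inner_angle geo \<epsilon> \<eta> g T x)
      - (\<Sum>T | T \<in> F \<and> x \<in> T. inner_angle geo \<epsilon> \<eta> f T x))" for x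
    by (simp only: sum_subtractf flip: sum_distrib_left)
  have "\<delta> x * (curvature geo F \<epsilon> \<eta> g x - curvature geo F \<epsilon> \<eta> f x) = - (\<Sum>T | T \<in> F \<and> x \<in> T. ?D x T)" for x
    unfolding curvature_def * by algebra
  then have "(\<Sum>x\<in>V. \<delta> x * (curvature geo F \<epsilon> \<eta> g x - curvature geo F \<epsilon> \<eta> f x)) = - (\<Sum>x\<in>V. \<Sum>T | T \<in> F \<and> x \<in> T. ?D x T)"
    by (simp only: sum_negf)
  also have "(\<Sum>x\<in>V. \<Sum>T | T \<in> F \<and> x \<in> T. ?D x T) = (\<Sum>T\<in>F. \<Sum>x | x \<in> V \<and> x \<in> T. ?D x T)"
    using fin finF by (rule sum.swap_restrict)
  also have "\<dots> = (\<Sum>T\<in>F. \<Sum>x\<in>T. ?D x T)"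
    using VF by (intro sum.cong refl) auto
  finally show ?thesis .
qed

text \<open>\<open>P\<close> marks the faces without strict decrease: constant difference in the
  Euclidean case, zero difference in the hyperbolic one. The curvature sum is minus the face sum;
  both are nonpositive, so both vanish, and so does every summand.\<close>

lemma alpha_curvature_rigidity:
  fixes f g :: "'v \<Rightarrow> real" and geo :: geometry
  defines "\<delta> \<equiv> \<lambda>x. conformal_coord geo \<epsilon> g x - conformal_coord geo \<epsilon> f x"
  assumes R: "\<And>i. i \<in> V \<Longrightarrow> \<alpha> * R i \<le> 0"
    and f: "has_alpha_curvature geo V F \<epsilon> \<eta> \<alpha> R f" and g: "has_alpha_curvature geo V F \<epsilon> \<eta> \<alpha> R g"
    and face: "\<And>T. T \<in> F \<Longrightarrow> \<not> P T \<Longrightarrow>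
      (\<Sum>x\<in>T. \<delta> x * (inner_angle geo \<epsilon> \<eta> g T x - inner_angle geo \<epsilon> \<eta> f T x)) < 0"
    and P: "\<And>T. T \<in> F \<Longrightarrow> P T \<Longrightarrow>
      (\<Sum>x\<in>T. \<delta> x * (inner_angle geo \<epsilon> \<eta> g T x - inner_angle geo \<epsilon> \<eta> f T x)) \<le> 0"
  shows "\<And>T. T \<in> F \<Longrightarrow> P T" "\<And>i. i \<in> V \<Longrightarrow> \<alpha> * R i \<noteq> 0 \<Longrightarrow> \<delta> i = 0"
proof -
  let ?S = "\<lambda>T. \<Sum>x\<in>T. \<delta> x * (inner_angle geo \<epsilon> \<eta> g T x - inner_angle geo \<epsilon> \<eta> f T x)"
  let ?u = "conformal_coord geo \<epsilon> f" and ?v = "conformal_coord geo \<epsilon> g"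
  let ?K = "\<lambda>x. (R x * exp (\<alpha> * ?v x) - R x * exp (\<alpha> * ?u x)) * (?v x - ?u x)"
  have S: "?S T \<le> 0" if "T \<in> F" for T using face[OF that] P[OF that] by fastforce
  have K: "curvature geo F \<epsilon> \<eta> f x = R x * exp (\<alpha> * ?u x)" "curvature geo F \<epsilon> \<eta> g x = R x * exp (\<alpha> * ?v x)"
    if "x \<in> V" for x
    using f g that by (auto simp: has_alpha_curvature_def alpha_curvature_def field_simps)
  have "sum ?K V = (\<Sum>x\<in>V. \<delta> x * (curvature geo F \<epsilon> \<eta> g x - curvature geo F \<epsilon> \<eta> f x))"
    by (intro sum.cong) (simp_all add: K \<delta>_def mult.commute)
  also have "\<dots> = - sum ?S F" by (rule angle_sum_swap)
  finally have eq: "sum ?K V = - sum ?S F" .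
  have K_le: "?K x \<le> 0" if "x \<in> V" for x using exp_monotone(1)[OF R[OF that]] .
  have "sum ?S F \<le> 0" using S by (rule sum_nonpos)
  moreover have "sum ?K V \<le> 0" using K_le by (rule sum_nonpos)
  ultimately have sums: "sum ?S F = 0" "sum ?K V = 0" using eq by linarith+
  have S0: "?S T = 0" if "T \<in> F" for T
    by (rule sum_nonpos_eq_0D[where f = ?S, OF finF S sums(1) that])
  have K0: "?K x = 0" if "x \<in> V" for x
    by (rule sum_nonpos_eq_0D[where f = ?K, OF fin K_le sums(2) that])
  show "P T" if "T \<in> F" for T using face[OF that] S0[OF that] by fastforce
  show "\<delta> i = 0" if "i \<in> V" "\<alpha> * R i \<noteq> 0" for i
    using exp_monotone(2)[OF R[OF that(1)] that(2), of "?u i" "?v i"] K0[OF that(1)]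
    unfolding \<delta>_def by fastforce
qed

lemma Euclidean_rigidity:
  assumes conn: "connected (realization F)" and R: "\<And>i. i \<in> V \<Longrightarrow> \<alpha> * R i \<le> 0"
    and f: "has_alpha_curvature Euclidean V F \<epsilon> \<eta> \<alpha> R f" and g: "has_alpha_curvature Euclidean V F \<epsilon> \<eta> \<alpha> R g"
  shows "\<exists>c. \<forall>i\<in>V. g i = f i + c" "\<And>i. i \<in> V \<Longrightarrow> \<alpha> * R i \<noteq> 0 \<Longrightarrow> g i = f i"
proof -
  let ?P = "\<lambda>T. \<forall>x\<in>T. \<forall>y\<in>T. g x - f x = g y - f y"
  have dcs: "discrete_conformal_structure Euclidean F \<epsilon> \<eta> f" "discrete_conformal_structure Euclidean F \<epsilon> \<eta> g"
    using f g by (simp_all add: has_alpha_curvature_def)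
  have flat: "(\<Sum>x\<in>T. (g x - f x) * (inner_angle Euclidean \<epsilon> \<eta> g T x - inner_angle Euclidean \<epsilon> \<eta> f T x)) \<le> 0"
    if "T \<in> F" "?P T" for T
  proof -
    obtain i where "i \<in> T" using face_cases[OF \<open>T \<in> F\<close>] by blast
    have "g x - f x = g i - f i" if "x \<in> T" for x using \<open>?P T\<close> that \<open>i \<in> T\<close> by blast
    then have "g x = f x + (g i - f i)" if "x \<in> T" for x using that by (simp add: diff_eq_eq add.commute)
    then show ?thesis using euc_face_similar[OF dcs \<open>T \<in> F\<close>, of "g i - f i"] by simp
  qed
  note rigid = alpha_curvature_rigidity[where geo = Euclidean and P = ?P, OF R f g, unfolded conformal_coord.simps]
  have "?P T" if "T \<in> F" for T
    by (rule rigid(1)[OF _ euc_face_decreasing[OF dcs] flat that])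
  then have "\<exists>c. \<forall>x\<in>V. g x - f x = c"
    by (intro constant_of_connected_realization[OF fin VF conn]) blast
  then obtain c where "\<And>x. x \<in> V \<Longrightarrow> g x - f x = c" by blast
  then show "\<exists>c. \<forall>i\<in>V. g i = f i + c" by (intro exI[of _ c]) force
  show "g i = f i" if "i \<in> V" "\<alpha> * R i \<noteq> 0" for i
  proof -
    have "g i - f i = 0" by (rule rigid(2)[OF _ euc_face_decreasing[OF dcs] flat that])
    then show ?thesis by simp
  qed
qed

lemma Hyperbolic_rigidity:
  assumes R: "\<And>i. i \<in> V \<Longrightarrow> \<alpha> * R i \<le> 0" and "i \<in> V"
    and f: "has_alpha_curvature Hyperbolic V F \<epsilon> \<eta> \<alpha> R f" and g: "has_alpha_curvature Hyperbolic V F \<epsilon> \<eta> \<alpha> R g"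
  shows "g i = f i"
proof -
  let ?P = "\<lambda>T. \<forall>x\<in>T. conformal_coord Hyperbolic \<epsilon> g x - conformal_coord Hyperbolic \<epsilon> f x = 0"
  have dcs: "discrete_conformal_structure Hyperbolic F \<epsilon> \<eta> f" "discrete_conformal_structure Hyperbolic F \<epsilon> \<eta> g"
    using f g by (simp_all add: has_alpha_curvature_def)
  obtain T where T: "T \<in> F" "i \<in> T" using \<open>i \<in> V\<close> VF by blast
  have "?P T"
    by (rule alpha_curvature_rigidity(1)[where geo = Hyperbolic and P = ?P,
          OF R f g hyp_face_decreasing[OF dcs] _ T(1)]) (assumption | simp)+
  then have eq: "conformal_coord Hyperbolic \<epsilon> g i = conformal_coord Hyperbolic \<epsilon> f i" using T by simp
  \<comment> \<open>\<open>hyp_radius\<close> recovers \<open>exp (f i)\<close> from the conformal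
    coordinate, which is thus injective in \<open>f i\<close>.\<close>
  have "exp (g i) = exp (f i)"
    using conformal_coord_Hyperbolic(2)[of \<epsilon> i, OF eps[OF \<open>i \<in> V\<close>]] eq by metis
  then show ?thesis by simp
qed

end

theorem theorem1p3:
  fixes M :: "'a topology"
    and V :: "'v set" and E F :: "'v set set"
    and \<epsilon> :: "'v \<Rightarrow> real" and \<eta> :: "'v set \<Rightarrow> real"
    and \<alpha> :: real and R :: "'v \<Rightarrow> real"
  assumes "closed_surface M" and "connected_space M"
    and "surface_triangulation M V E F"
    and "\<And>i. i \<in> V \<Longrightarrow> \<epsilon> i \<in> {0, 1}"
    and "\<And>s t. {s, t} \<in> E \<Longrightarrow> \<epsilon> s * \<epsilon> t + \<eta> {s, t} > 0"
    and "\<And>q s t. {q, s, t} \<in> F \<Longrightarrow> \<epsilon> q * \<eta> {s, t} + \<eta> {q, s} * \<eta> {q, t} \<ge> 0"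
  shows
    "((\<forall>i\<in>V. \<alpha> * R i = 0) \<longrightarrow>
        (\<forall>f g. has_alpha_curvature Euclidean V F \<epsilon> \<eta> \<alpha> R f \<and>
               has_alpha_curvature Euclidean V F \<epsilon> \<eta> \<alpha> R g \<longrightarrow>
               (\<exists>c. \<forall>i\<in>V. g i = f i + c))) \<and>
     ((\<forall>i\<in>V. \<alpha> * R i \<le> 0) \<and> \<not> (\<forall>i\<in>V. \<alpha> * R i = 0) \<longrightarrow>
        (\<forall>f g. has_alpha_curvature Euclidean V F \<epsilon> \<eta> \<alpha> R f \<and>
               has_alpha_curvature Euclidean V F \<epsilon> \<eta> \<alpha> R g \<longrightarrow>
               (\<forall>i\<in>V. g i = f i))) \<and>
     ((\<forall>i\<in>V. \<alpha> * R i \<le> 0) \<longrightarrow>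
        (\<forall>f g. has_alpha_curvature Hyperbolic V F \<epsilon> \<eta> \<alpha> R f \<and>
               has_alpha_curvature Hyperbolic V F \<epsilon> \<eta> \<alpha> R g \<longrightarrow>
               (\<forall>i\<in>V. g i = f i)))"
proof -
  have tri: "finite V" "V = \<Union>F" "\<And>T. T \<in> F \<Longrightarrow> card T = 3"
      "E = {e. card e = 2 \<and> (\<exists>T\<in>F. e \<subseteq> T)}"
    using assms(3) by (auto simp: surface_triangulation_def)
  interpret weighted_triangulation V F \<epsilon> \<eta>
  proof
    show "\<epsilon> s * \<epsilon> t + \<eta> {s, t} > 0" if "{s, t, q} \<in> F" "s \<noteq> t" for s t q
      using that by (intro assms(5)) (auto simp: tri(4) intro: bexI[OF _ that(1)])
  qed (use tri assms(4,6) in auto)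
  have conn: "connected (realization F)" using assms(2,3) by (rule surface_triangulation_connected)
  show ?thesis
  proof (intro conjI impI allI)
    fix f g
    assume R: "\<forall>i\<in>V. \<alpha> * R i = 0"
      and fg: "has_alpha_curvature Euclidean V F \<epsilon> \<eta> \<alpha> R f \<and> has_alpha_curvature Euclidean V F \<epsilon> \<eta> \<alpha> R g"
    have "\<And>i. i \<in> V \<Longrightarrow> \<alpha> * R i \<le> 0" using R by (metis order_refl)
    then show "\<exists>c. \<forall>i\<in>V. g i = f i + c" using Euclidean_rigidity(1)[OF conn] fg by blast
  next
    fix f g
    assume R: "(\<forall>i\<in>V. \<alpha> * R i \<le> 0) \<and> \<not> (\<forall>i\<in>V. \<alpha> * R i = 0)"
      and "has_alpha_curvature Euclidean V F \<epsilon> \<eta> \<alpha> R f \<and> has_alpha_curvature Euclidean V F \<epsilon> \<eta> \<alpha> R g"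
    then have fg: "has_alpha_curvature Euclidean V F \<epsilon> \<eta> \<alpha> R f" "has_alpha_curvature Euclidean V F \<epsilon> \<eta> \<alpha> R g"
      by auto
    have R': "\<And>i. i \<in> V \<Longrightarrow> \<alpha> * R i \<le> 0" using R by blast
    obtain c where c: "\<And>i. i \<in> V \<Longrightarrow> g i = f i + c" using Euclidean_rigidity(1)[OF conn R' fg] by blast
    \<comment> \<open>A vertex where \<open>\<alpha> * R j\<close> is nonzero forces the additive
      constant \<open>c\<close> to be 0.\<close>
    obtain j where "j \<in> V" "\<alpha> * R j \<noteq> 0" using R by blast
    then have "g j = f j" using Euclidean_rigidity(2)[OF conn R' fg] by blast
    then show "\<forall>i\<in>V. g i = f i" using c \<open>j \<in> V\<close> by force
  next
    fix f g
    assume "\<forall>i\<in>V. \<alpha> * R i \<le> 0"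
      and "has_alpha_curvature Hyperbolic V F \<epsilon> \<eta> \<alpha> R f \<and> has_alpha_curvature Hyperbolic V F \<epsilon> \<eta> \<alpha> R g"
    then show "\<forall>i\<in>V. g i = f i" using Hyperbolic_rigidity by blast
  qed
qed

end
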